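(* If the Prime Ideal Theorem holds, then the adjunction $\mathbf{Clop}_+\dashv\mathbf{Sk}_{\rm Pervin}$, where $\mathbf{Clop}_+:\mathbf{BiTop}\to\mathbf{Pervin}$ and $\mathbf{Sk}_{\rm Pervin}:\mathbf{Pervin}\to\mathbf{BiTop}$, restricts to an equivalence of categories between the category $\mathbf{BiTop}_{\rm KZ}$ of $T_0$, compact and zero-dimensional bitopological spaces and the category $\mathbf{CPervin}$ of $T_0$ complete Pervin spaces.
   Context: Prime Ideal Theorem: every proper ideal of a bounded distributive lattice extends to a prime ideal. (The Axiom of Choice is not assumed.) A Pervin space is a pair $(X,\mathcal S)$ with $X$ a set and $\mathcal S$ a bounded sublattice of $\mathcal P(X)$. A morphism $(X,\mathcal S)\to(Y,\mathcal T)$ is a function $f$ with $f^{-1}(T)\in\mathcal S$ for all $T\in\mathcal T$; the category is $\mathbf{Pervin}$. $\Omega_{\mathcal S}(X)$ is the topology generated by $\mathcal S$; $(X,\mathcal S)$ is $T_0$ if this topology is $T_0$. $f$ is dense if $f[X]$ is dense in $(Y,\Omega_{\mathcal T}(Y))$, and it is an extremal monomorphism if and only if it is injective and every $S\in\mathcal S$ is $f^{-1}(T)$ for some $T\in\mathcal T$. $(X,\mathcal S)$ is symmetric if $\mathcal S$ is a Boolean algebra. A symmetric Pervin space is complete if every dense extremal monomorphism from it into a $T_0$ symmetric Pervin space is an isomorphism. A Pervin space $(X,\mathcal S)$ is complete if $(X,\overline{\mathcal S})$ is complete, where $\overline{\mathcal S}$ is the Boolean subalgebra of $\mathcal P(X)$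 generated by $\mathcal S$. $\mathbf{CPervin}$ is the full subcategory of $\mathbf{Pervin}$ determined by the $T_0$ complete ones. A bitopological space (bispace) is a triple $\mathcal X=(X,\tau_+,\tau_-)$ with $\tau_+,\tau_-$ topologies on $X$; morphisms are functions continuous with respect to both the first and the second topologies; the category is $\mathbf{BiTop}$. The patch topology is the topology generated by $\tau_+\cup\tau_-$; the bispace is $T_0$ (resp. compact) if its patch topology is. A positive clopen is an element of $\tau_+$ whose complement is in $\tau_-$; a negative clopen is an element of $\tau_-$ whose complement is in $\tau_+$; $\mathrm{Clop}_+(\mathcal X)$ is the lattice of positive clopens. The bispace is zero-dimensional if every element of $\tau_+$ is a union of positive clopens and every element of $\tau_-$ is a union of negative clopens. $\mathbf{BiTop}_{\rm KZ}$ is a full subcategory of $\mathbf{BiTop}$. $\mathbf{Sk}_{\rm Pervin}(X,\mathcal S)=(X,\Omega_{\mathcal S}(X),\Omega_{\mathcal S^c}(X))$ with $\mathcal S^c=\{X\setminus S\mid S\in\mathcal S\}$; $\mathbf{Clop}_+(\mathcal X)=(X,\mathrm{Clop}_+(\mathcal X))$; both functors leave underlying functions unchanged. *)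

theory Defs
  imports "HOL-Analysis.Analysis" "HOL-Algebra.Lattice"
begin

section \<open>Categories, adjunctions, equivalences\<close>

text \<open>Categories are given by families of hom-sets, which need not be disjoint; hence identities,
  composition and the arrow part of a functor take the objects involved as arguments.
  \<open>Cmp C A B D g f\<close> is the composite of \<open>f : A \<rightarrow> B\<close> and \<open>g : B \<rightarrow> D\<close>.\<close>

record ('o, 'm) cat =
  Obj :: "'o set"
  Hom :: "'o \<Rightarrow> 'o \<Rightarrow> 'm set"
  Idt :: "'o \<Rightarrow> 'm"
  Cmp :: "'o \<Rightarrow> 'o \<Rightarrow> 'o \<Rightarrow> 'm \<Rightarrow> 'm \<Rightarrow> 'm"

locale category =
  fixes C :: "('o, 'm) cat"
  assumes idt_in_hom: "A \<in> Obj C \<Longrightarrow> Idt C A \<in> Hom C A A"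
    and cmp_in_hom: "\<lbrakk>A \<in> Obj C; B \<in> Obj C; D \<in> Obj C; f \<in> Hom C A B; g \<in> Hom C B D\<rbrakk>
      \<Longrightarrow> Cmp C A B D g f \<in> Hom C A D"
    and idt_left: "\<lbrakk>A \<in> Obj C; B \<in> Obj C; f \<in> Hom C A B\<rbrakk> \<Longrightarrow> Cmp C A B B (Idt C B) f = f"
    and idt_right: "\<lbrakk>A \<in> Obj C; B \<in> Obj C; f \<in> Hom C A B\<rbrakk> \<Longrightarrow> Cmp C A A B f (Idt C A) = f"
    and cmp_assoc: "\<lbrakk>A \<in> Obj C; B \<in> Obj C; D \<in> Obj C; E \<in> Obj C;
        f \<in> Hom C A B; g \<in> Hom C B D; h \<in> Hom C D E\<rbrakk>
      \<Longrightarrow> Cmp C A D E h (Cmp C A B D g f) = Cmp C A B E (Cmp C B D E h g) f"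

definition iso_arrow :: "('o, 'm) cat \<Rightarrow> 'o \<Rightarrow> 'o \<Rightarrow> 'm \<Rightarrow> bool" where
  "iso_arrow C A B f \<longleftrightarrow> f \<in> Hom C A B \<and>
     (\<exists>g \<in> Hom C B A. Cmp C A B A g f = Idt C A \<and> Cmp C B A B f g = Idt C B)"

definition full_subcategory :: "('o, 'm) cat \<Rightarrow> ('o \<Rightarrow> bool) \<Rightarrow> ('o, 'm) cat" where
  "full_subcategory C P = C\<lparr>Obj := {A \<in> Obj C. P A}\<rparr>"

record ('o, 'm, 'p, 'n) ftor =
  on_obj :: "'o \<Rightarrow> 'p"
  on_arr :: "'o \<Rightarrow> 'o \<Rightarrow> 'm \<Rightarrow> 'n"

locale cat_functor = dom: category C + cod: category D
  for C :: "('o, 'm) cat" and D :: "('p, 'n) cat" +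
  fixes F :: "('o, 'm, 'p, 'n) ftor"
  assumes obj_closed: "A \<in> Obj C \<Longrightarrow> on_obj F A \<in> Obj D"
    and arr_closed: "\<lbrakk>A \<in> Obj C; B \<in> Obj C; f \<in> Hom C A B\<rbrakk>
      \<Longrightarrow> on_arr F A B f \<in> Hom D (on_obj F A) (on_obj F B)"
    and pres_idt: "A \<in> Obj C \<Longrightarrow> on_arr F A A (Idt C A) = Idt D (on_obj F A)"
    and pres_cmp: "\<lbrakk>A \<in> Obj C; B \<in> Obj C; E \<in> Obj C; f \<in> Hom C A B; g \<in> Hom C B E\<rbrakk>
      \<Longrightarrow> on_arr F A E (Cmp C A B E g f) =
          Cmp D (on_obj F A) (on_obj F B) (on_obj F E) (on_arr F B E g) (on_arr F A B f)"

definition id_ftor :: "('o, 'm, 'o, 'm) ftor" where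
  "id_ftor = \<lparr>on_obj = (\<lambda>A. A), on_arr = (\<lambda>A B f. f)\<rparr>"

definition comp_ftor ::
  "('p, 'n, 'q, 'k) ftor \<Rightarrow> ('o, 'm, 'p, 'n) ftor \<Rightarrow> ('o, 'm, 'q, 'k) ftor" where
  "comp_ftor G F = \<lparr>on_obj = (\<lambda>A. on_obj G (on_obj F A)),
     on_arr = (\<lambda>A B f. on_arr G (on_obj F A) (on_obj F B) (on_arr F A B f))\<rparr>"

locale nat_trans = src: cat_functor C D F + tgt: cat_functor C D G
  for C :: "('o, 'm) cat" and D :: "('p, 'n) cat"
    and F :: "('o, 'm, 'p, 'n) ftor" and G :: "('o, 'm, 'p, 'n) ftor" +
  fixes \<tau> :: "'o \<Rightarrow> 'n"
  assumes component: "A \<in> Obj C \<Longrightarrow> \<tau> A \<in> Hom D (on_obj F A) (on_obj G A)"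
    and natural: "\<lbrakk>A \<in> Obj C; B \<in> Obj C; f \<in> Hom C A B\<rbrakk>
      \<Longrightarrow> Cmp D (on_obj F A) (on_obj G A) (on_obj G B) (on_arr G A B f) (\<tau> A) =
          Cmp D (on_obj F A) (on_obj F B) (on_obj G B) (\<tau> B) (on_arr F A B f)"

text \<open>\<open>F : C \<rightarrow> D\<close> is left adjoint to \<open>G : D \<rightarrow> C\<close> with unit \<open>\<eta>\<close> and counit \<open>\<epsilon>\<close>.\<close>

locale adjunction =
  left: cat_functor C D F + right: cat_functor D C G +
  unit: nat_trans C C id_ftor "comp_ftor G F" \<eta> +
  counit: nat_trans D D "comp_ftor F G" id_ftor \<epsilon>
  for C :: "('o, 'm) cat" and D :: "('p, 'n) cat"
    and F :: "('o, 'm, 'p, 'n) ftor" and G :: "('p, 'n, 'o, 'm) ftor"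
    and \<eta> :: "'o \<Rightarrow> 'm" and \<epsilon> :: "'p \<Rightarrow> 'n" +
  assumes triangle_left: "A \<in> Obj C \<Longrightarrow>
      Cmp D (on_obj F A) (on_obj F (on_obj G (on_obj F A))) (on_obj F A)
        (\<epsilon> (on_obj F A)) (on_arr F A (on_obj G (on_obj F A)) (\<eta> A)) = Idt D (on_obj F A)"
    and triangle_right: "B \<in> Obj D \<Longrightarrow>
      Cmp C (on_obj G B) (on_obj G (on_obj F (on_obj G B))) (on_obj G B)
        (on_arr G (on_obj F (on_obj G B)) B (\<epsilon> B)) (\<eta> (on_obj G B)) = Idt C (on_obj G B)"

locale adjoint_equivalence = adjunction +
  assumes unit_iso: "A \<in> Obj C \<Longrightarrow> iso_arrow C A (on_obj G (on_obj F A)) (\<eta> A)"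
    and counit_iso: "B \<in> Obj D \<Longrightarrow> iso_arrow D (on_obj F (on_obj G B)) B (\<epsilon> B)"


section \<open>The Prime Ideal Theorem\<close>

definition distributive_lattice :: "'l gorder \<Rightarrow> bool" where
  "distributive_lattice L \<longleftrightarrow> lattice L \<and>
     (\<forall>x \<in> carrier L. \<forall>y \<in> carrier L. \<forall>z \<in> carrier L.
        x \<sqinter>\<^bsub>L\<^esub> (y \<squnion>\<^bsub>L\<^esub> z) = (x \<sqinter>\<^bsub>L\<^esub> y) \<squnion>\<^bsub>L\<^esub> (x \<sqinter>\<^bsub>L\<^esub> z))"

definition lattice_ideal :: "'l gorder \<Rightarrow> 'l set \<Rightarrow> bool" where
  "lattice_ideal L I \<longleftrightarrow> I \<subseteq> carrier L \<and> I \<noteq> {} \<and>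
     (\<forall>x \<in> carrier L. \<forall>y \<in> I. x \<sqsubseteq>\<^bsub>L\<^esub> y \<longrightarrow> x \<in> I) \<and>
     (\<forall>x \<in> I. \<forall>y \<in> I. x \<squnion>\<^bsub>L\<^esub> y \<in> I)"

definition proper_lattice_ideal :: "'l gorder \<Rightarrow> 'l set \<Rightarrow> bool" where
  "proper_lattice_ideal L I \<longleftrightarrow> lattice_ideal L I \<and> I \<noteq> carrier L"

definition prime_lattice_ideal :: "'l gorder \<Rightarrow> 'l set \<Rightarrow> bool" where
  "prime_lattice_ideal L P \<longleftrightarrow> proper_lattice_ideal L P \<and>
     (\<forall>x \<in> carrier L. \<forall>y \<in> carrier L. x \<sqinter>\<^bsub>L\<^esub> y \<in> P \<longrightarrow> x \<in> P \<or> y \<in> P)"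

text \<open>The Prime Ideal Theorem for lattices whose elements are drawn from the type \<open>'l\<close>.\<close>

definition prime_ideal_theorem :: "'l itself \<Rightarrow> bool" where
  "prime_ideal_theorem _ \<longleftrightarrow>
     (\<forall>(L :: 'l gorder) I. bounded_lattice L \<and> distributive_lattice L \<and> proper_lattice_ideal L I
        \<longrightarrow> (\<exists>P. prime_lattice_ideal L P \<and> I \<subseteq> P))"


section \<open>Pervin spaces\<close>

record 'a pervin =
  points :: "'a set"
  blocks :: "'a set set"

definition pervin_space :: "'a pervin \<Rightarrow> bool" where
  "pervin_space P \<longleftrightarrow> blocks P \<subseteq> Pow (points P) \<and> {} \<in> blocks P \<and> points P \<in> blocks P \<and>
     (\<forall>S \<in> blocks P. \<forall>T \<in> blocks P. S \<union> T \<in> blocks P \<and> S \<inter> T \<in> blocks P)"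

text \<open>Functions between carriers are represented by their extensional representatives
  (\<open>undefined\<close> outside the domain), so that equality of arrows is equality in HOL.\<close>

definition pervin_hom :: "'a pervin \<Rightarrow> 'b pervin \<Rightarrow> ('a \<Rightarrow> 'b) set" where
  "pervin_hom P Q = {f \<in> points P \<rightarrow>\<^sub>E points Q. \<forall>T \<in> blocks Q. f -` T \<inter> points P \<in> blocks P}"

definition pervin_topology :: "'a pervin \<Rightarrow> 'a topology" where
  "pervin_topology P = topology_generated_by (blocks P)"

definition pervin_t0 :: "'a pervin \<Rightarrow> bool" where
  "pervin_t0 P \<longleftrightarrow> t0_space (pervin_topology P)"

definition pervin_dense :: "'a pervin \<Rightarrow> 'b pervin \<Rightarrow> ('a \<Rightarrow> 'b) \<Rightarrow> bool" where
  "pervin_dense P Q f \<longleftrightarrow> pervin_topology Q closure_of (f ` points P) = points Q"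

definition pervin_extremal_mono :: "'a pervin \<Rightarrow> 'b pervin \<Rightarrow> ('a \<Rightarrow> 'b) \<Rightarrow> bool" where
  "pervin_extremal_mono P Q f \<longleftrightarrow> f \<in> pervin_hom P Q \<and> inj_on f (points P) \<and>
     (\<forall>S \<in> blocks P. \<exists>T \<in> blocks Q. S = f -` T \<inter> points P)"

definition pervin_iso :: "'a pervin \<Rightarrow> 'b pervin \<Rightarrow> ('a \<Rightarrow> 'b) \<Rightarrow> bool" where
  "pervin_iso P Q f \<longleftrightarrow> f \<in> pervin_hom P Q \<and>
     (\<exists>g \<in> pervin_hom Q P. (\<forall>x \<in> points P. g (f x) = x) \<and> (\<forall>y \<in> points Q. f (g y) = y))"

text \<open>\<^const>\<open>algebra\<close> is the library's predicate for Boolean subalgebras of a powerset.\<close>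

definition pervin_symmetric :: "'a pervin \<Rightarrow> bool" where
  "pervin_symmetric P \<longleftrightarrow> pervin_space P \<and> algebra (points P) (blocks P)"

definition symmetrization :: "'a pervin \<Rightarrow> 'a pervin" where
  "symmetrization P = \<lparr>points = points P, blocks = algebra (points P) hull blocks P\<rparr>"

text \<open>HOL cannot quantify over the type of the points of the codomain. The type \<open>'a set set\<close> is
  large enough for this not to matter: by density, a point \<open>y\<close> of the codomain \<open>Q\<close> is determined
  by the set of all preimages of the members of \<open>blocks Q\<close> that contain \<open>y\<close>. See the lemma
  \<open>symmetric_complete_any_type\<close> below.\<close>

definition symmetric_complete :: "'a pervin \<Rightarrow> bool" where
  "symmetric_complete P \<longleftrightarrow>
     (\<forall>(Q :: 'a set set pervin) f. pervin_symmetric Q \<and> pervin_t0 Q \<and>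
        pervin_dense P Q f \<and> pervin_extremal_mono P Q f \<longrightarrow> pervin_iso P Q f)"

definition pervin_complete :: "'a pervin \<Rightarrow> bool" where
  "pervin_complete P \<longleftrightarrow> symmetric_complete (symmetrization P)"

definition Pervin :: "('a pervin, 'a \<Rightarrow> 'a) cat" where
  "Pervin = \<lparr>Obj = {P. pervin_space P}, Hom = pervin_hom,
     Idt = (\<lambda>P. \<lambda>x \<in> points P. x), Cmp = (\<lambda>P Q R g f. compose (points P) g f)\<rparr>"

definition CPervin :: "('a pervin, 'a \<Rightarrow> 'a) cat" where
  "CPervin = full_subcategory Pervin (\<lambda>P. pervin_t0 P \<and> pervin_complete P)"


section \<open>Bitopological spaces\<close>

record 'a bispace =
  bpoints :: "'a set"
  pos :: "'a topology"
  neg :: "'a topology"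

definition bitopological_space :: "'a bispace \<Rightarrow> bool" where
  "bitopological_space X \<longleftrightarrow> topspace (pos X) = bpoints X \<and> topspace (neg X) = bpoints X"

definition bispace_hom :: "'a bispace \<Rightarrow> 'b bispace \<Rightarrow> ('a \<Rightarrow> 'b) set" where
  "bispace_hom X Y = {f \<in> bpoints X \<rightarrow>\<^sub>E bpoints Y.
     continuous_map (pos X) (pos Y) f \<and> continuous_map (neg X) (neg Y) f}"

definition patch :: "'a bispace \<Rightarrow> 'a topology" where
  "patch X = topology_generated_by ({U. openin (pos X) U} \<union> {U. openin (neg X) U})"

definition clop_pos :: "'a bispace \<Rightarrow> 'a set set" where
  "clop_pos X = {U. openin (pos X) U \<and> openin (neg X) (bpoints X - U)}"

definition clop_neg :: "'a bispace \<Rightarrow> 'a set set" where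
  "clop_neg X = {U. openin (neg X) U \<and> openin (pos X) (bpoints X - U)}"

definition bispace_zero_dimensional :: "'a bispace \<Rightarrow> bool" where
  "bispace_zero_dimensional X \<longleftrightarrow>
     (\<forall>U. openin (pos X) U \<longrightarrow> (\<exists>\<U> \<subseteq> clop_pos X. U = \<Union>\<U>)) \<and>
     (\<forall>U. openin (neg X) U \<longrightarrow> (\<exists>\<U> \<subseteq> clop_neg X. U = \<Union>\<U>))"

definition BiTop :: "('a bispace, 'a \<Rightarrow> 'a) cat" where
  "BiTop = \<lparr>Obj = {X. bitopological_space X}, Hom = bispace_hom,
     Idt = (\<lambda>X. \<lambda>x \<in> bpoints X. x), Cmp = (\<lambda>X Y Z g f. compose (bpoints X) g f)\<rparr>"

definition BiTop_KZ :: "('a bispace, 'a \<Rightarrow> 'a) cat" where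
  "BiTop_KZ = full_subcategory BiTop
     (\<lambda>X. t0_space (patch X) \<and> compact_space (patch X) \<and> bispace_zero_dimensional X)"


section \<open>The functors and the adjunction\<close>

definition Sk_Pervin :: "('a pervin, 'a \<Rightarrow> 'a, 'a bispace, 'a \<Rightarrow> 'a) ftor" where
  "Sk_Pervin = \<lparr>on_obj = (\<lambda>P. \<lparr>bpoints = points P, pos = topology_generated_by (blocks P),
       neg = topology_generated_by ((\<lambda>S. points P - S) ` blocks P)\<rparr>),
     on_arr = (\<lambda>P Q f. f)\<rparr>"

definition Clop_Pos :: "('a bispace, 'a \<Rightarrow> 'a, 'a pervin, 'a \<Rightarrow> 'a) ftor" where
  "Clop_Pos = \<lparr>on_obj = (\<lambda>X. \<lparr>points = bpoints X, blocks = clop_pos X\<rparr>),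
     on_arr = (\<lambda>X Y f. f)\<rparr>"

text \<open>Both functors fix underlying sets and functions, and the hom-set bijection of the adjunction
  is \<open>f \<mapsto> f\<close>; so unit and counit are carried by identity functions (which are in
  general not isomorphisms).\<close>

definition Clop_Sk_unit :: "'a bispace \<Rightarrow> 'a \<Rightarrow> 'a" where
  "Clop_Sk_unit X = (\<lambda>x \<in> bpoints X. x)"

definition Clop_Sk_counit :: "'a pervin \<Rightarrow> 'a \<Rightarrow> 'a" where
  "Clop_Sk_counit P = (\<lambda>x \<in> points P. x)"


section \<open>Completeness does not depend on the type of the codomain\<close>

lemma topspace_pervin:
  assumes "pervin_space P"
  shows "topspace (pervin_topology P) = points P"
  using assms unfolding pervin_space_def pervin_topology_def by auto

lemma generate_topology_separates:
  assumes "generate_topology_on B U" "x \<in> U" "y \<notin> U"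
  shows "\<exists>T \<in> B. x \<in> T \<and> y \<notin> T \<or> y \<in> T \<and> x \<notin> T"
  using assms by (induction rule: generate_topology_on.induct) auto

lemma pervin_t0_iff:
  assumes "pervin_space P"
  shows "pervin_t0 P \<longleftrightarrow> (\<forall>x \<in> points P. \<forall>y \<in> points P. x \<noteq> y \<longrightarrow>
           (\<exists>T \<in> blocks P. \<not> (x \<in> T \<longleftrightarrow> y \<in> T)))" (is "_ \<longleftrightarrow> ?R")
proof
  assume t: "pervin_t0 P"
  show ?R
  proof (intro ballI impI)
    fix x y assume "x \<in> points P" "y \<in> points P" "x \<noteq> y"
    then obtain U where U: "openin (pervin_topology P) U" "\<not> (x \<in> U \<longleftrightarrow> y \<in> U)"
      using t assms unfolding pervin_t0_def t0_space_def by (metis topspace_pervin)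
    then have "generate_topology_on (blocks P) U"
      by (simp add: pervin_topology_def openin_topology_generated_by_iff)
    then show "\<exists>T \<in> blocks P. \<not> (x \<in> T \<longleftrightarrow> y \<in> T)"
      using U(2) generate_topology_separates by metis
  qed
next
  assume ?R
  then show "pervin_t0 P"
    unfolding pervin_t0_def t0_space_def topspace_pervin[OF assms]
    by (metis pervin_topology_def topology_generated_by_Basis)
qed

lemma pervin_dense_meets:
  assumes "pervin_space Q" "pervin_dense P Q f" "T \<in> blocks Q" "T \<noteq> {}"
  shows "\<exists>x \<in> points P. f x \<in> T"
proof -
  obtain y where y: "y \<in> T" "y \<in> points Q"
    using assms unfolding pervin_space_def by auto
  have "openin (pervin_topology Q) T"
    using assms by (simp add: pervin_topology_def topology_generated_by_Basis)
  then show ?thesis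
    using y assms(2) unfolding pervin_dense_def closure_of_def by auto
qed

lemma pervin_dense_if_meets:
  assumes "pervin_space Q" "\<And>T. T \<in> blocks Q \<Longrightarrow> T \<noteq> {} \<Longrightarrow> \<exists>x \<in> points P. f x \<in> T"
  shows "pervin_dense P Q f"
proof -
  have base: "\<exists>T \<in> blocks Q. y \<in> T \<and> T \<subseteq> U"
    if "generate_topology_on (blocks Q) U" "y \<in> U" for U y
    using that
  proof (induction arbitrary: y rule: generate_topology_on.induct)
    case (Int U V)
    then obtain S T where "S \<in> blocks Q" "y \<in> S" "S \<subseteq> U" "T \<in> blocks Q" "y \<in> T" "T \<subseteq> V"
      by (metis IntE)
    then show ?case
      using assms(1) unfolding pervin_space_def by (intro bexI[of _ "S \<inter> T"]) auto
  next
    case (UN K)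
    then obtain k where "k \<in> K" "y \<in> k" by blast
    with UN.IH obtain T where "T \<in> blocks Q" "y \<in> T" "T \<subseteq> k" by metis
    then show ?case using \<open>k \<in> K\<close> by blast
  qed auto
  have "y \<in> pervin_topology Q closure_of (f ` points P)" if "y \<in> points Q" for y
  proof -
    have "\<exists>z \<in> f ` points P. z \<in> U" if U: "y \<in> U" "openin (pervin_topology Q) U" for U
    proof -
      have "generate_topology_on (blocks Q) U"
        using U by (simp add: pervin_topology_def openin_topology_generated_by_iff)
      then obtain T where "T \<in> blocks Q" "y \<in> T" "T \<subseteq> U" using base U(1) by blast
      then show ?thesis using assms(2)[of T] by blast
    qed
    then show ?thesis
      using that unfolding in_closure_of topspace_pervin[OF assms(1)] by blast
  qed
  then show ?thesis
    unfolding pervin_dense_def using closure_of_subset_topspace topspace_pervin[OF assms(1)]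
    by (metis subsetI subset_antisym)
qed

lemma symmetric_complete_any_type:
  fixes P :: "'a pervin" and Q :: "'b pervin"
  assumes complete: "symmetric_complete P"
    and sym: "pervin_symmetric Q" and t0: "pervin_t0 Q"
    and dense: "pervin_dense P Q f" and extr: "pervin_extremal_mono P Q f"
  shows "pervin_iso P Q f"
proof -
  have Q: "pervin_space Q" and alg: "algebra (points Q) (blocks Q)"
    using sym unfolding pervin_symmetric_def by auto
  have sub: "T \<subseteq> points Q" if "T \<in> blocks Q" for T
    using Q that unfolding pervin_space_def by auto
  have fhom: "f \<in> pervin_hom P Q" using extr unfolding pervin_extremal_mono_def by auto
  then have fmap: "f x \<in> points Q" if "x \<in> points P" for x
    using that unfolding pervin_hom_def by auto
  have inj_pre: "T = T'"
    if T: "T \<in> blocks Q" "T' \<in> blocks Q" and eq: "f -` T \<inter> points P = f -` T' \<inter> points P" for T T'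
  proof -
    have "T - T' \<in> blocks Q" "T' - T \<in> blocks Q"
      using alg T unfolding algebra_iff_Un by (meson alg algebra.axioms(1) ring_of_sets.Diff)+
    then show ?thesis
      using pervin_dense_meets[OF Q dense, of "T - T'"] pervin_dense_meets[OF Q dense, of "T' - T"] eq
      by blast
  qed
  define h where "h y = {S. \<exists>T \<in> blocks Q. y \<in> T \<and> S = f -` T \<inter> points P}" for y
  have h_iff: "f -` T \<inter> points P \<in> h y \<longleftrightarrow> y \<in> T" if "T \<in> blocks Q" for T y
    unfolding h_def using inj_pre that by blast
  have inj: "inj_on h (points Q)"
    using t0 unfolding pervin_t0_iff[OF Q] inj_on_def by (metis h_iff)
  define Q' where "Q' = \<lparr>points = h ` points Q, blocks = image h ` blocks Q\<rparr>"
  have hT: "h y \<in> h ` T \<longleftrightarrow> y \<in> T" if "T \<in> blocks Q" "y \<in> points Q" for T y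
    using inj sub[OF that(1)] that(2) by (meson inj_on_image_mem_iff)
  have "algebra (points Q') (blocks Q')"
    unfolding algebra_iff_Un
  proof (intro conjI ballI)
    show "blocks Q' \<subseteq> Pow (points Q')" unfolding Q'_def using sub by auto
    show "{} \<in> blocks Q'" using Q unfolding Q'_def pervin_space_def by auto
    show "points Q' - A \<in> blocks Q'" if A: "A \<in> blocks Q'" for A
    proof -
      obtain T where T: "T \<in> blocks Q" "A = h ` T" using A unfolding Q'_def by auto
      have "points Q - T \<in> blocks Q" using alg T(1) unfolding algebra_iff_Un by auto
      moreover have "points Q' - A = h ` (points Q - T)"
        using inj_on_image_set_diff[OF inj, of "points Q" T] sub[OF T(1)] T(2) unfolding Q'_def
        by auto
      ultimately show ?thesis unfolding Q'_def by auto
    qed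
    show "A \<union> B \<in> blocks Q'" if AB: "A \<in> blocks Q'" "B \<in> blocks Q'" for A B
    proof -
      obtain S T where "S \<in> blocks Q" "A = h ` S" "T \<in> blocks Q" "B = h ` T"
        using AB unfolding Q'_def by auto
      then show ?thesis
        using Q unfolding Q'_def pervin_space_def by (auto simp: image_Un[symmetric])
    qed
  qed
  moreover from this have "pervin_space Q'"
    unfolding pervin_space_def
    by (metis algebra.top algebra_iff_Int algebra_iff_Un)
  ultimately have sym': "pervin_symmetric Q'" and Q': "pervin_space Q'"
    unfolding pervin_symmetric_def by auto
  have t0': "pervin_t0 Q'"
    unfolding pervin_t0_iff[OF Q']
  proof (intro ballI impI)
    fix u v assume "u \<in> points Q'" "v \<in> points Q'" "u \<noteq> v"
    then obtain x y where xy: "x \<in> points Q" "y \<in> points Q" "u = h x" "v = h y" "x \<noteq> y"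
      unfolding Q'_def by auto
    then obtain T where "T \<in> blocks Q" "\<not> (x \<in> T \<longleftrightarrow> y \<in> T)"
      using t0 unfolding pervin_t0_iff[OF Q] by blast
    then show "\<exists>T \<in> blocks Q'. \<not> (u \<in> T \<longleftrightarrow> v \<in> T)"
      using hT xy unfolding Q'_def by auto
  qed
  define f' where "f' = restrict (h \<circ> f) (points P)"
  have pre: "f' -` (h ` T) \<inter> points P = f -` T \<inter> points P" if "T \<in> blocks Q" for T
  proof -
    have "f' x \<in> h ` T \<longleftrightarrow> f x \<in> T" if "x \<in> points P" for x
      using hT[OF \<open>T \<in> blocks Q\<close> fmap[OF that]] that unfolding f'_def by simp
    then show ?thesis by auto
  qed
  have "pervin_dense P Q' f'"
  proof (rule pervin_dense_if_meets[OF Q'])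
    fix A assume "A \<in> blocks Q'" "A \<noteq> {}"
    then obtain T where T: "T \<in> blocks Q" "A = h ` T" "T \<noteq> {}" unfolding Q'_def by auto
    then obtain x where "x \<in> points P" "f x \<in> T" using pervin_dense_meets[OF Q dense] by blast
    then show "\<exists>x \<in> points P. f' x \<in> A" using T unfolding f'_def by auto
  qed
  moreover have "pervin_extremal_mono P Q' f'"
    unfolding pervin_extremal_mono_def
  proof (intro conjI ballI)
    show "f' \<in> pervin_hom P Q'"
      using fhom fmap pre unfolding pervin_hom_def Q'_def by (auto simp: f'_def)
    show "inj_on f' (points P)"
      using extr inj fmap unfolding pervin_extremal_mono_def inj_on_def f'_def by simp
    fix S assume "S \<in> blocks P"
    then obtain T where "T \<in> blocks Q" "S = f -` T \<inter> points P"
      using extr unfolding pervin_extremal_mono_def by blast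
    then show "\<exists>T \<in> blocks Q'. S = f' -` T \<inter> points P"
      using pre unfolding Q'_def by auto
  qed
  ultimately have "pervin_iso P Q' f'"
    using complete sym' t0' unfolding symmetric_complete_def by blast
  then obtain g where g: "g \<in> pervin_hom Q' P" "\<And>x. x \<in> points P \<Longrightarrow> g (f' x) = x"
    "\<And>y. y \<in> points Q' \<Longrightarrow> f' (g y) = y"
    unfolding pervin_iso_def by blast
  define k where "k = restrict (g \<circ> h) (points Q)"
  have gmap: "g (h y) \<in> points P" if "y \<in> points Q" for y
    using g(1) that unfolding pervin_hom_def Q'_def by auto
  have fk: "f (k y) = y" if y: "y \<in> points Q" for y
  proof -
    have "h (f (g (h y))) = h y"
      using g(3)[of "h y"] y gmap unfolding f'_def Q'_def by auto
    then show ?thesis using inj fmap gmap y unfolding k_def inj_on_def by auto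
  qed
  have kf: "k (f x) = x" if "x \<in> points P" for x
    using g(2)[OF that] that fmap unfolding k_def f'_def by auto
  have "k \<in> pervin_hom Q P"
    unfolding pervin_hom_def
  proof (intro CollectI conjI ballI)
    show "k \<in> points Q \<rightarrow>\<^sub>E points P" using gmap unfolding k_def by auto
    fix S assume "S \<in> blocks P"
    then obtain T where T: "T \<in> blocks Q" "S = f -` T \<inter> points P"
      using extr unfolding pervin_extremal_mono_def by blast
    have "k -` S \<inter> points Q = T"
      using fk gmap sub[OF T(1)] T(2) unfolding k_def by auto
    then show "k -` S \<inter> points Q \<in> blocks Q" using T(1) by simp
  qed
  then show ?thesis
    unfolding pervin_iso_def using fhom kf fk by blast
qed

end

theory Submission
  imports Defs
begin

text \<open>Unit and counit are carried by identity functions, so the adjunction amounts to two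
  inclusions: the positive clopens of a bispace generate coarser topologies than the given ones, and
  every block of a Pervin space is a positive clopen of its bispace. The equivalence then says that
  the two functors restrict to the subcategories and that, on the objects there, both inclusions are
  equalities (\<open>Sk_Pervin_Clop_Pos\<close> and \<open>Clop_Pos_Sk_Pervin\<close>).

  For a bispace, zero-dimensionality says precisely that the positive clopens and their complements
  generate the two topologies. If the patch topology is moreover compact, then the Pervin space of
  positive clopens is complete (\<open>pervin_complete_Clop_Pos\<close>): given a dense extension by a \<open>T\<^sub>0\<close>
  symmetric space \<open>Q\<close>, the traces on the original space of the blocks around a point of \<open>Q\<close> are
  patch-closed and have the finite intersection property, and a point common to all of them is
  mapped to the given point. So nothing has been added.

  Conversely, let \<open>(X, \<S>)\<close> be a \<open>T\<^sub>0\<close> complete Pervin space and \<open>\<B>\<close> the Boolean algebra generated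
  by \<open>\<S>\<close>. The Stone space of \<open>\<B>\<close>, whose points are the ultrafilters of \<open>\<B>\<close>, is a dense extension
  of \<open>(X, \<B>)\<close>; by completeness it adds no points, so every ultrafilter of \<open>\<B>\<close> consists of the
  members of \<open>\<B>\<close> that contain some fixed point (\<open>ultrafilter_principal\<close>). Given a patch-open cover
  of \<open>X\<close> without finite subcover, the members of \<open>\<B>\<close> that are covered by finitely many sets of the
  cover form a proper ideal. The Prime Ideal Theorem extends it to a prime ideal, whose complement
  is an ultrafilter, fixed at some point \<open>x\<close>. But a basic neighbourhood of \<open>x\<close> inside a set of the
  cover lies both in the ideal and in the ultrafilter. Hence the patch topology is compact
  (\<open>compact_patch_Sk_Pervin\<close>). A positive clopen is then patch-compact and a union of members of
  \<open>\<S>\<close>, hence a finite union of such, and so itself a member of \<open>\<S>\<close>.\<close>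

section \<open>Adjunctions restricted to full subcategories\<close>

lemma full_subcategory_simps:
  "Obj (full_subcategory C P) = {A \<in> Obj C. P A}"
  "Hom (full_subcategory C P) = Hom C"
  "Idt (full_subcategory C P) = Idt C"
  "Cmp (full_subcategory C P) = Cmp C"
  by (simp_all add: full_subcategory_def)

lemma category_full_subcategory:
  assumes "category C"
  shows "category (full_subcategory C P)"
proof -
  interpret category C by fact
  show ?thesis
    by unfold_locales
      (auto simp: full_subcategory_simps idt_in_hom idt_left idt_right
        intro: cmp_in_hom cmp_assoc)
qed

lemma cat_functor_full_subcategory:
  assumes "cat_functor C D F" "\<And>A. \<lbrakk>A \<in> Obj C; P A\<rbrakk> \<Longrightarrow> Q (on_obj F A)"
  shows "cat_functor (full_subcategory C P) (full_subcategory D Q) F"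
proof -
  interpret cat_functor C D F by fact
  interpret sub_dom: category "full_subcategory C P"
    by (rule category_full_subcategory) unfold_locales
  interpret sub_cod: category "full_subcategory D Q"
    by (rule category_full_subcategory) unfold_locales
  show ?thesis
    by unfold_locales
      (auto simp: full_subcategory_simps obj_closed pres_idt assms(2) intro: arr_closed pres_cmp)
qed

lemma nat_trans_full_subcategory:
  assumes "nat_trans C D F G \<tau>"
    and "\<And>A. \<lbrakk>A \<in> Obj C; P A\<rbrakk> \<Longrightarrow> Q (on_obj F A)" "\<And>A. \<lbrakk>A \<in> Obj C; P A\<rbrakk> \<Longrightarrow> Q (on_obj G A)"
  shows "nat_trans (full_subcategory C P) (full_subcategory D Q) F G \<tau>"
proof -
  interpret nat_trans C D F G \<tau> by fact
  show ?thesis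
    using cat_functor_full_subcategory[OF src.cat_functor_axioms, of P Q]
      cat_functor_full_subcategory[OF tgt.cat_functor_axioms, of P Q] assms(2,3) component natural
    by (simp add: nat_trans_def nat_trans_axioms_def full_subcategory_simps)
qed

text \<open>Fullness makes every arrow involved, in particular the components of unit and counit, an arrow of
  the subcategories as soon as both functors preserve the defining properties of the objects.\<close>

lemma adjunction_full_subcategory:
  assumes "adjunction C D F G \<eta> \<epsilon>"
    and F: "\<And>A. \<lbrakk>A \<in> Obj C; P A\<rbrakk> \<Longrightarrow> Q (on_obj F A)"
    and G: "\<And>B. \<lbrakk>B \<in> Obj D; Q B\<rbrakk> \<Longrightarrow> P (on_obj G B)"
  shows "adjunction (full_subcategory C P) (full_subcategory D Q) F G \<eta> \<epsilon>"
proof -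
  interpret adjunction C D F G \<eta> \<epsilon> by fact
  have "nat_trans (full_subcategory C P) (full_subcategory C P) id_ftor (comp_ftor G F) \<eta>"
    by (rule nat_trans_full_subcategory[OF unit.nat_trans_axioms])
      (auto simp: id_ftor_def comp_ftor_def F G left.obj_closed)
  moreover have "nat_trans (full_subcategory D Q) (full_subcategory D Q) (comp_ftor F G) id_ftor \<epsilon>"
    by (rule nat_trans_full_subcategory[OF counit.nat_trans_axioms])
      (auto simp: id_ftor_def comp_ftor_def F G right.obj_closed)
  ultimately show ?thesis
    using cat_functor_full_subcategory[OF left.cat_functor_axioms, of P Q]
      cat_functor_full_subcategory[OF right.cat_functor_axioms, of Q P] F G triangle_left triangle_right
    by (simp add: adjunction_def adjunction_axioms_def full_subcategory_simps)
qed

lemma (in category) iso_arrow_idt: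
  assumes "A \<in> Obj C"
  shows "iso_arrow C A A (Idt C A)"
  unfolding iso_arrow_def using assms idt_in_hom idt_left by blast

section \<open>The adjunction between bitopological spaces and Pervin spaces\<close>

lemma comp_restrict_id:
  assumes "f \<in> A \<rightarrow>\<^sub>E B"
  shows "compose A f (\<lambda>x\<in>A. x) = f" "compose A (\<lambda>x\<in>B. x) f = f"
  using assms by (auto simp: PiE_def intro: compose_Id Id_compose)

lemma restrict_id_vimage:
  assumes "T \<subseteq> A"
  shows "(\<lambda>x\<in>A. x) -` T \<inter> A = T"
  using assms by auto

lemma pervin_hom_comp:
  assumes "f \<in> pervin_hom P Q" "g \<in> pervin_hom Q R"
  shows "compose (points P) g f \<in> pervin_hom P R"
proof -
  have f: "f \<in> points P \<rightarrow> points Q" using assms(1) unfolding pervin_hom_def by auto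
  then have "compose (points P) g f -` T \<inter> points P = f -` (g -` T \<inter> points Q) \<inter> points P" for T
    by (auto simp: compose_def)
  moreover have "compose (points P) g f \<in> points P \<rightarrow>\<^sub>E points R"
    using f assms(2) unfolding pervin_hom_def by (auto simp: compose_def)
  ultimately show ?thesis
    using assms unfolding pervin_hom_def by (simp del: vimage_Int)
qed

lemma category_Pervin: "category (Pervin :: ('a pervin, 'a \<Rightarrow> 'a) cat)"
proof
  fix A :: "'a pervin"
  assume "A \<in> Obj Pervin"
  then have "(\<lambda>x\<in>points A. x) -` T \<inter> points A = T" if "T \<in> blocks A" for T
    using that by (intro restrict_id_vimage) (auto simp: Pervin_def pervin_space_def)
  then show "Idt Pervin A \<in> Hom Pervin A A"
    by (auto simp: Pervin_def pervin_hom_def)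
next
  fix A B D and f g
  assume "A \<in> Obj Pervin" "B \<in> Obj Pervin" "D \<in> Obj Pervin" "f \<in> Hom Pervin A B" "g \<in> Hom Pervin B D"
  then show "Cmp Pervin A B D g f \<in> Hom Pervin A D"
    by (simp add: Pervin_def pervin_hom_comp[of f A B g D])
next
  fix A B f
  assume "f \<in> Hom Pervin A B"
  then have "f \<in> points A \<rightarrow>\<^sub>E points B" by (simp add: Pervin_def pervin_hom_def)
  then show "Cmp Pervin A B B (Idt Pervin B) f = f" "Cmp Pervin A A B f (Idt Pervin A) = f"
    by (simp_all add: Pervin_def comp_restrict_id)
next
  fix A B D E f g h
  assume "f \<in> Hom Pervin A B"
  then have "f \<in> points A \<rightarrow> points B" by (auto simp: Pervin_def pervin_hom_def)
  then show "Cmp Pervin A D E h (Cmp Pervin A B D g f) = Cmp Pervin A B E (Cmp Pervin B D E h g) f"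
    by (simp add: Pervin_def compose_assoc)
qed

lemma bispace_hom_comp:
  assumes "f \<in> bispace_hom X Y" "g \<in> bispace_hom Y Z" "bitopological_space X"
  shows "compose (bpoints X) g f \<in> bispace_hom X Z"
proof -
  have "compose (bpoints X) g f \<in> bpoints X \<rightarrow>\<^sub>E bpoints Z"
    using assms unfolding bispace_hom_def by (auto simp: compose_def)
  moreover have "continuous_map (pos X) (pos Z) (g \<circ> f)" "continuous_map (neg X) (neg Z) (g \<circ> f)"
    using assms continuous_map_compose unfolding bispace_hom_def by blast+
  then have "continuous_map (pos X) (pos Z) (compose (bpoints X) g f)"
    "continuous_map (neg X) (neg Z) (compose (bpoints X) g f)"
    using assms(3) unfolding bitopological_space_def
    by (simp_all add: compose_def continuous_map_eq[of _ _ "g \<circ> f"])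
  ultimately show ?thesis by (simp add: bispace_hom_def)
qed

lemma category_BiTop: "category (BiTop :: ('a bispace, 'a \<Rightarrow> 'a) cat)"
proof
  fix A :: "'a bispace"
  assume "A \<in> Obj BiTop"
  then show "Idt BiTop A \<in> Hom BiTop A A"
    by (simp add: BiTop_def bispace_hom_def bitopological_space_def
        continuous_map_eq[OF continuous_map_id])
next
  fix A B D and f g
  assume "A \<in> Obj BiTop" "B \<in> Obj BiTop" "D \<in> Obj BiTop" "f \<in> Hom BiTop A B" "g \<in> Hom BiTop B D"
  then show "Cmp BiTop A B D g f \<in> Hom BiTop A D"
    by (simp add: BiTop_def bispace_hom_comp[of f A B g D])
next
  fix A B f
  assume "f \<in> Hom BiTop A B"
  then have "f \<in> bpoints A \<rightarrow>\<^sub>E bpoints B" by (simp add: BiTop_def bispace_hom_def)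
  then show "Cmp BiTop A B B (Idt BiTop B) f = f" "Cmp BiTop A A B f (Idt BiTop A) = f"
    by (simp_all add: BiTop_def comp_restrict_id)
next
  fix A B D E f g h
  assume "f \<in> Hom BiTop A B"
  then have "f \<in> bpoints A \<rightarrow> bpoints B" by (auto simp: BiTop_def bispace_hom_def)
  then show "Cmp BiTop A D E h (Cmp BiTop A B D g f) = Cmp BiTop A B E (Cmp BiTop B D E h g) f"
    by (simp add: BiTop_def compose_assoc)
qed

lemma clop_pos_vimage:
  assumes "f \<in> bispace_hom X Y" "bitopological_space X" "T \<in> clop_pos Y"
  shows "f -` T \<inter> bpoints X \<in> clop_pos X"
proof -
  have "f -` T \<inter> bpoints X = {x \<in> topspace (pos X). f x \<in> T}"
    "bpoints X - f -` T \<inter> bpoints X = {x \<in> topspace (neg X). f x \<in> bpoints Y - T}"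
    using assms(1,2) unfolding bitopological_space_def bispace_hom_def by auto
  moreover have "continuous_map (pos X) (pos Y) f" "continuous_map (neg X) (neg Y) f"
    "openin (pos Y) T" "openin (neg Y) (bpoints Y - T)"
    using assms(1,3) unfolding clop_pos_def bispace_hom_def by auto
  then have "openin (pos X) {x \<in> topspace (pos X). f x \<in> T}"
    "openin (neg X) {x \<in> topspace (neg X). f x \<in> bpoints Y - T}"
    using openin_continuous_map_preimage[of "pos X" "pos Y" f T]
      openin_continuous_map_preimage[of "neg X" "neg Y" f "bpoints Y - T"] by blast+
  ultimately show ?thesis by (simp only: clop_pos_def mem_Collect_eq)
qed

lemma pervin_space_Clop_Pos:
  assumes "bitopological_space X"
  shows "pervin_space (on_obj Clop_Pos X)"
proof -
  have "openin (pos X) (bpoints X)" "openin (neg X) (bpoints X)"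
    using assms unfolding bitopological_space_def by (metis openin_topspace)+
  then show ?thesis
    using assms unfolding pervin_space_def Clop_Pos_def clop_pos_def bitopological_space_def
    by (auto simp: Diff_Un Diff_Int dest: openin_subset)
qed

lemma bitopological_space_Sk_Pervin:
  assumes "pervin_space P"
  shows "bitopological_space (on_obj Sk_Pervin P)"
  using assms unfolding pervin_space_def bitopological_space_def Sk_Pervin_def by auto

lemma Sk_Pervin_arrow:
  assumes "f \<in> pervin_hom P Q" "pervin_space P" "pervin_space Q"
  shows "f \<in> bispace_hom (on_obj Sk_Pervin P) (on_obj Sk_Pervin Q)"
proof -
  have f: "f \<in> points P \<rightarrow> points Q" using assms(1) unfolding pervin_hom_def by auto
  have tops: "\<Union>(blocks P) = points P" "\<Union>((-) (points P) ` blocks P) = points P"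
    "\<Union>(blocks Q) = points Q" "\<Union>((-) (points Q) ` blocks Q) = points Q"
    using assms(2,3) unfolding pervin_space_def by auto
  have pre: "f -` T \<inter> points P \<in> blocks P" if "T \<in> blocks Q" for T
    using assms(1) that unfolding pervin_hom_def by auto
  have "continuous_map (topology_generated_by (blocks P)) (topology_generated_by (blocks Q)) f"
    using f pre unfolding continuous_on_generated_topo_iff topology_generated_by_topspace tops
    by (blast intro: topology_generated_by_Basis)
  moreover have "openin (topology_generated_by ((-) (points P) ` blocks P)) (f -` U \<inter> points P)"
    if U: "U \<in> (-) (points Q) ` blocks Q" for U
  proof -
    obtain T where T: "T \<in> blocks Q" "U = points Q - T" using U by blast
    then have "f -` U \<inter> points P = points P - (f -` T \<inter> points P)" using f by auto
    then show ?thesis using pre[OF T(1)] topology_generated_by_Basis by (metis imageI)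
  qed
  then have "continuous_map (topology_generated_by ((-) (points P) ` blocks P))
      (topology_generated_by ((-) (points Q) ` blocks Q)) f"
    using f unfolding continuous_on_generated_topo_iff topology_generated_by_topspace tops
    by blast
  ultimately show ?thesis
    using assms(1) by (simp add: bispace_hom_def Sk_Pervin_def pervin_hom_def)
qed

lemma cat_functor_Clop_Pos:
  "cat_functor (BiTop :: ('a bispace, 'a \<Rightarrow> 'a) cat) Pervin Clop_Pos"
proof -
  interpret B: category "BiTop :: ('a bispace, 'a \<Rightarrow> 'a) cat" by (rule category_BiTop)
  interpret P: category "Pervin :: ('a pervin, 'a \<Rightarrow> 'a) cat" by (rule category_Pervin)
  show ?thesis
  proof
    show "on_arr Clop_Pos X Y f \<in> Hom Pervin (on_obj Clop_Pos X) (on_obj Clop_Pos Y)"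
      if "X \<in> Obj BiTop" "Y \<in> Obj BiTop" "f \<in> Hom BiTop X Y" for X Y :: "'a bispace" and f
      using that clop_pos_vimage[of f X Y]
      by (auto simp: BiTop_def Pervin_def Clop_Pos_def pervin_hom_def)
        (auto simp: bispace_hom_def)
  qed (auto simp: BiTop_def Pervin_def pervin_space_Clop_Pos, auto simp: Clop_Pos_def)
qed

lemma cat_functor_Sk_Pervin:
  "cat_functor Pervin (BiTop :: ('a bispace, 'a \<Rightarrow> 'a) cat) Sk_Pervin"
proof -
  interpret B: category "BiTop :: ('a bispace, 'a \<Rightarrow> 'a) cat" by (rule category_BiTop)
  interpret P: category "Pervin :: ('a pervin, 'a \<Rightarrow> 'a) cat" by (rule category_Pervin)
  show ?thesis
  proof
    show "on_arr Sk_Pervin P Q f \<in> Hom BiTop (on_obj Sk_Pervin P) (on_obj Sk_Pervin Q)"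
      if "P \<in> Obj Pervin" "Q \<in> Obj Pervin" "f \<in> Hom Pervin P Q" for P Q :: "'a pervin" and f
      using that Sk_Pervin_arrow[of f P Q] by (simp add: Pervin_def BiTop_def) (simp add: Sk_Pervin_def)
  qed (auto simp: BiTop_def Pervin_def bitopological_space_Sk_Pervin, auto simp: Sk_Pervin_def)
qed

text \<open>Continuity of the unit: members of \<^term>\<open>clop_pos X\<close> are open in \<^term>\<open>pos X\<close> and their complements in
  \<^term>\<open>neg X\<close>, so the topologies that they generate are coarser than those of \<^term>\<open>X\<close>.\<close>

lemma Clop_Sk_unit_arrow:
  assumes "bitopological_space X"
  shows "Clop_Sk_unit X \<in> bispace_hom X (on_obj Sk_Pervin (on_obj Clop_Pos X))"
proof -
  have tops: "topspace (pos X) = bpoints X" "topspace (neg X) = bpoints X"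
    using assms unfolding bitopological_space_def by auto
  have P: "pervin_space (on_obj Clop_Pos X)" using assms by (rule pervin_space_Clop_Pos)
  then have un: "\<Union>(clop_pos X) = bpoints X" "\<Union>((-) (bpoints X) ` clop_pos X) = bpoints X"
    unfolding pervin_space_def Clop_Pos_def by auto
  have id: "Clop_Sk_unit X \<in> bpoints X \<rightarrow> bpoints X" by (auto simp: Clop_Sk_unit_def)
  have vimage: "Clop_Sk_unit X -` S \<inter> bpoints X = S" if "S \<subseteq> bpoints X" for S
    using that unfolding Clop_Sk_unit_def by (rule restrict_id_vimage)
  have sub: "S \<subseteq> bpoints X" if "S \<in> clop_pos X" for S
    using P that unfolding pervin_space_def Clop_Pos_def by auto
  have pre_pos: "openin (pos X) (Clop_Sk_unit X -` S \<inter> bpoints X)" if "S \<in> clop_pos X" for S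
    using that vimage[OF sub[OF that]] unfolding clop_pos_def by simp
  have pre_neg: "openin (neg X) (Clop_Sk_unit X -` (bpoints X - S) \<inter> bpoints X)"
    if "S \<in> clop_pos X" for S
    using that vimage[of "bpoints X - S"] unfolding clop_pos_def by simp
  have "continuous_map (pos X) (topology_generated_by (clop_pos X)) (Clop_Sk_unit X)"
    using id pre_pos unfolding continuous_on_generated_topo_iff un tops by blast
  moreover have
    "continuous_map (neg X) (topology_generated_by ((-) (bpoints X) ` clop_pos X)) (Clop_Sk_unit X)"
    using id pre_neg unfolding continuous_on_generated_topo_iff un tops by blast
  ultimately show ?thesis
    by (simp add: bispace_hom_def Sk_Pervin_def Clop_Pos_def) (simp add: Clop_Sk_unit_def)
qed

lemma blocks_subset_clop_pos_Sk_Pervin: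
  "blocks P \<subseteq> clop_pos (on_obj Sk_Pervin P)"
  by (auto simp: clop_pos_def Sk_Pervin_def intro!: topology_generated_by_Basis)

lemma Clop_Sk_counit_arrow:
  assumes "pervin_space P"
  shows "Clop_Sk_counit P \<in> pervin_hom (on_obj Clop_Pos (on_obj Sk_Pervin P)) P"
proof -
  have "Clop_Sk_counit P -` T \<inter> points P = T" if "T \<in> blocks P" for T
    using that assms unfolding Clop_Sk_counit_def pervin_space_def
    by (intro restrict_id_vimage) auto
  then show ?thesis
    using blocks_subset_clop_pos_Sk_Pervin[of P]
    by (auto simp: pervin_hom_def Clop_Pos_def) (auto simp: Clop_Sk_counit_def Sk_Pervin_def)
qed

text \<open>Both functors leave the underlying functions unchanged and the components are identity functions,
  so naturality and the triangle laws reduce to the unit laws for composition.\<close>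

lemma adjunction_Clop_Sk:
  "adjunction (BiTop :: ('a bispace, 'a \<Rightarrow> 'a) cat) Pervin
     Clop_Pos Sk_Pervin Clop_Sk_unit Clop_Sk_counit"
proof -
  interpret left: cat_functor "BiTop :: ('a bispace, 'a \<Rightarrow> 'a) cat" Pervin Clop_Pos
    by (rule cat_functor_Clop_Pos)
  interpret right: cat_functor Pervin "BiTop :: ('a bispace, 'a \<Rightarrow> 'a) cat" Sk_Pervin
    by (rule cat_functor_Sk_Pervin)
  have id_B: "cat_functor BiTop (BiTop :: ('a bispace, 'a \<Rightarrow> 'a) cat) id_ftor"
    by unfold_locales (auto simp: id_ftor_def)
  have id_P: "cat_functor Pervin (Pervin :: ('a pervin, 'a \<Rightarrow> 'a) cat) id_ftor"
    by unfold_locales (auto simp: id_ftor_def)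
  have SC: "cat_functor BiTop (BiTop :: ('a bispace, 'a \<Rightarrow> 'a) cat) (comp_ftor Sk_Pervin Clop_Pos)"
    by unfold_locales
      (auto simp: comp_ftor_def left.obj_closed left.arr_closed left.pres_idt left.pres_cmp
        right.obj_closed right.arr_closed right.pres_idt right.pres_cmp)
  have CS: "cat_functor Pervin (Pervin :: ('a pervin, 'a \<Rightarrow> 'a) cat) (comp_ftor Clop_Pos Sk_Pervin)"
    by unfold_locales
      (auto simp: comp_ftor_def left.obj_closed left.arr_closed left.pres_idt left.pres_cmp
        right.obj_closed right.arr_closed right.pres_idt right.pres_cmp)
  have "nat_trans BiTop (BiTop :: ('a bispace, 'a \<Rightarrow> 'a) cat) id_ftor
      (comp_ftor Sk_Pervin Clop_Pos) Clop_Sk_unit"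
  proof (intro nat_trans.intro nat_trans_axioms.intro id_B SC)
    fix X Y :: "'a bispace" and f
    assume "X \<in> Obj BiTop"
    then show "Clop_Sk_unit X \<in> Hom BiTop (on_obj id_ftor X) (on_obj (comp_ftor Sk_Pervin Clop_Pos) X)"
      using Clop_Sk_unit_arrow[of X] by (simp add: BiTop_def id_ftor_def comp_ftor_def)
    assume "f \<in> Hom BiTop X Y"
    then have "f \<in> bpoints X \<rightarrow>\<^sub>E bpoints Y" by (simp add: BiTop_def bispace_hom_def)
    then show "Cmp BiTop (on_obj id_ftor X) (on_obj (comp_ftor Sk_Pervin Clop_Pos) X)
        (on_obj (comp_ftor Sk_Pervin Clop_Pos) Y) (on_arr (comp_ftor Sk_Pervin Clop_Pos) X Y f)
        (Clop_Sk_unit X) = Cmp BiTop (on_obj id_ftor X) (on_obj id_ftor Y)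
        (on_obj (comp_ftor Sk_Pervin Clop_Pos) Y) (Clop_Sk_unit Y) (on_arr id_ftor X Y f)"
      by (simp add: BiTop_def id_ftor_def comp_ftor_def Clop_Pos_def Sk_Pervin_def
          Clop_Sk_unit_def comp_restrict_id)
  qed
  moreover have "nat_trans Pervin (Pervin :: ('a pervin, 'a \<Rightarrow> 'a) cat)
      (comp_ftor Clop_Pos Sk_Pervin) id_ftor Clop_Sk_counit"
  proof (intro nat_trans.intro nat_trans_axioms.intro id_P CS)
    fix P Q :: "'a pervin" and f
    assume "P \<in> Obj Pervin"
    then show "Clop_Sk_counit P \<in> Hom Pervin (on_obj (comp_ftor Clop_Pos Sk_Pervin) P) (on_obj id_ftor P)"
      using Clop_Sk_counit_arrow[of P] by (simp add: Pervin_def id_ftor_def comp_ftor_def)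
    assume "f \<in> Hom Pervin P Q"
    then have "f \<in> points P \<rightarrow>\<^sub>E points Q" by (simp add: Pervin_def pervin_hom_def)
    then show "Cmp Pervin (on_obj (comp_ftor Clop_Pos Sk_Pervin) P) (on_obj id_ftor P)
        (on_obj id_ftor Q) (on_arr id_ftor P Q f) (Clop_Sk_counit P) =
        Cmp Pervin (on_obj (comp_ftor Clop_Pos Sk_Pervin) P) (on_obj (comp_ftor Clop_Pos Sk_Pervin) Q)
        (on_obj id_ftor Q) (Clop_Sk_counit Q) (on_arr (comp_ftor Clop_Pos Sk_Pervin) P Q f)"
      by (simp add: Pervin_def id_ftor_def comp_ftor_def Clop_Pos_def Sk_Pervin_def
          Clop_Sk_counit_def comp_restrict_id)
  qed
  moreover have "adjunction_axioms (BiTop :: ('a bispace, 'a \<Rightarrow> 'a) cat) Pervin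
      Clop_Pos Sk_Pervin Clop_Sk_unit Clop_Sk_counit"
    by unfold_locales
      (auto simp: BiTop_def Pervin_def Clop_Pos_def Sk_Pervin_def Clop_Sk_unit_def
        Clop_Sk_counit_def compose_def)
  ultimately show ?thesis
    using left.cat_functor_axioms right.cat_functor_axioms by (rule_tac adjunction.intro)
qed

section \<open>Compact zero-dimensional bispaces yield complete Pervin spaces\<close>

text \<open>A generated topology has the base \<open>B\<close> if \<open>B\<close> is closed under binary intersection and refines the
  generators. Since \<open>B\<close> may differ from the generating family, this covers the two topologies of
  \<open>Sk_Pervin\<close>, where \<open>B\<close> is the generating family, and the patch topology, where it is the
  generated Boolean algebra.\<close>

lemma generated_topology_base:
  assumes "openin (topology_generated_by \<G>) U" "x \<in> U"
    and "\<And>S T. \<lbrakk>S \<in> B; T \<in> B\<rbrakk> \<Longrightarrow> S \<inter> T \<in> B"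
    and "\<And>G x. \<lbrakk>G \<in> \<G>; x \<in> G\<rbrakk> \<Longrightarrow> \<exists>S \<in> B. x \<in> S \<and> S \<subseteq> G"
  shows "\<exists>S \<in> B. x \<in> S \<and> S \<subseteq> U"
proof -
  have "generate_topology_on \<G> U"
    using assms(1) by (simp add: openin_topology_generated_by_iff)
  then show ?thesis
    using assms(2)
  proof (induction arbitrary: x rule: generate_topology_on.induct)
    case (Int U V)
    then obtain S T where "S \<in> B" "x \<in> S" "S \<subseteq> U" "T \<in> B" "x \<in> T" "T \<subseteq> V"
      by (metis IntE)
    then show ?case using assms(3) by (intro bexI[of _ "S \<inter> T"]) auto
  next
    case (UN K)
    then obtain V where "V \<in> K" "x \<in> V" by blast
    with UN.IH obtain S where "S \<in> B" "x \<in> S" "S \<subseteq> V" by metis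
    then show ?case using \<open>V \<in> K\<close> by blast
  qed (use assms(4) in auto)
qed

lemma openin_patch:
  assumes "openin (pos X) U \<or> openin (neg X) U"
  shows "openin (patch X) U"
  using assms unfolding patch_def by (auto intro: topology_generated_by_Basis)

lemma topspace_patch:
  assumes "bitopological_space X"
  shows "topspace (patch X) = bpoints X"
proof -
  have "\<Union>{U. openin \<tau> U} = topspace \<tau>" for \<tau> :: "'a topology"
    by (auto dest: openin_subset)
  then show ?thesis
    using assms by (simp add: patch_def bitopological_space_def Union_Un_distrib)
qed

text \<open>Points separated by a patch-open set are separated by a set of the generating family, that is, by
  an open set of one of the two topologies; zero-dimensionality shrinks it to a clopen, and a negative
  clopen separates the same points as its complement, which is positive.\<close>

lemma pervin_t0_Clop_Pos:
  assumes X: "bitopological_space X" and "t0_space (patch X)" "bispace_zero_dimensional X"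
  shows "pervin_t0 (on_obj Clop_Pos X)"
  unfolding pervin_t0_iff[OF pervin_space_Clop_Pos[OF X]]
proof (intro ballI impI)
  fix x y assume "x \<in> points (on_obj Clop_Pos X)" "y \<in> points (on_obj Clop_Pos X)" "x \<noteq> y"
  then have xy: "x \<in> bpoints X" "y \<in> bpoints X" "x \<noteq> y" by (simp_all add: Clop_Pos_def)
  then obtain U where "openin (patch X) U" "\<not> (x \<in> U \<longleftrightarrow> y \<in> U)"
    using assms(2) unfolding t0_space_def topspace_patch[OF X] by metis
  then have "generate_topology_on ({U. openin (pos X) U} \<union> {U. openin (neg X) U}) U"
    by (simp add: patch_def openin_topology_generated_by_iff)
  then obtain V where "V \<in> {U. openin (pos X) U} \<union> {U. openin (neg X) U}"
    and V2: "\<not> (x \<in> V \<longleftrightarrow> y \<in> V)"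
    using generate_topology_separates[of _ U x y] generate_topology_separates[of _ U y x]
      \<open>\<not> (x \<in> U \<longleftrightarrow> y \<in> U)\<close> by meson
  then have V1: "openin (pos X) V \<or> openin (neg X) V" by simp
  from V1 show "\<exists>S \<in> blocks (on_obj Clop_Pos X). \<not> (x \<in> S \<longleftrightarrow> y \<in> S)"
  proof
    assume "openin (pos X) V"
    then obtain \<U> where "\<U> \<subseteq> clop_pos X" "V = \<Union>\<U>"
      using assms(3) unfolding bispace_zero_dimensional_def by blast
    then show ?thesis using V2 unfolding Clop_Pos_def by auto
  next
    assume "openin (neg X) V"
    then obtain \<U> where \<U>: "\<U> \<subseteq> clop_neg X" "V = \<Union>\<U>"
      using assms(3) unfolding bispace_zero_dimensional_def by blast
    then obtain S where S: "S \<in> clop_neg X" "\<not> (x \<in> S \<longleftrightarrow> y \<in> S)" using V2 by blast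
    then have "S \<subseteq> bpoints X"
      using X openin_subset unfolding clop_neg_def bitopological_space_def by blast
    then have "bpoints X - S \<in> clop_pos X"
      using S(1) unfolding clop_neg_def clop_pos_def by (simp add: double_diff)
    moreover have "\<not> (x \<in> bpoints X - S \<longleftrightarrow> y \<in> bpoints X - S)" using S(2) xy by blast
    ultimately show ?thesis unfolding Clop_Pos_def by (intro bexI[of _ "bpoints X - S"]) simp_all
  qed
qed

lemma topology_generated_by_eq:
  assumes "\<And>S. S \<in> \<B> \<Longrightarrow> openin \<tau> S" "\<And>U. openin \<tau> U \<Longrightarrow> \<exists>\<U> \<subseteq> \<B>. U = \<Union>\<U>"
  shows "topology_generated_by \<B> = \<tau>"
proof -
  have "openin \<tau> U" if "generate_topology_on \<B> U" for U
    using that assms(1) by induction auto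
  moreover have "openin (topology_generated_by \<B>) U" if U: "openin \<tau> U" for U
  proof -
    obtain \<U> where "\<U> \<subseteq> \<B>" "U = \<Union>\<U>" using assms(2)[OF U] by blast
    then show ?thesis using topology_generated_by_Basis[of _ \<B>] by (simp add: openin_Union subset_iff)
  qed
  ultimately show ?thesis
    unfolding topology_eq openin_topology_generated_by_iff by blast
qed

lemma clop_neg_eq:
  assumes "bitopological_space X"
  shows "clop_neg X = (\<lambda>S. bpoints X - S) ` clop_pos X"
proof -
  have "bpoints X - (bpoints X - U) = U" if "openin (pos X) U \<or> openin (neg X) U" for U
    using assms that openin_subset unfolding bitopological_space_def by (metis double_diff subset_refl)
  then show ?thesis
    unfolding clop_neg_def clop_pos_def by (force simp: image_iff)
qed

text \<open>Zero-dimensionality says that the positive clopens generate the first topology and the negative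
  clopens, which are their complements, the second.\<close>

lemma Sk_Pervin_Clop_Pos:
  assumes "bitopological_space X" "bispace_zero_dimensional X"
  shows "on_obj Sk_Pervin (on_obj Clop_Pos X) = X"
proof -
  have "topology_generated_by (clop_pos X) = pos X"
    using assms(2) by (intro topology_generated_by_eq)
      (auto simp: clop_pos_def[of X] bispace_zero_dimensional_def)
  moreover have "topology_generated_by (clop_neg X) = neg X"
    using assms(2) by (intro topology_generated_by_eq)
      (auto simp: clop_neg_def[of X] bispace_zero_dimensional_def)
  ultimately show ?thesis
    by (simp add: Sk_Pervin_def Clop_Pos_def clop_neg_eq[OF assms(1)])
qed

lemma algebra_hull:
  assumes "\<A> \<subseteq> Pow X"
  shows "algebra X (algebra X hull \<A>)"
proof -
  have "algebra X (Pow X)" by (rule algebra_Pow)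
  then show ?thesis
    unfolding algebra_iff_Un hull_def using assms by (auto simp: algebra_iff_Un)
qed

lemma pervin_symmetric_iff_algebra:
  "pervin_symmetric P \<longleftrightarrow> algebra (points P) (blocks P)"
proof
  assume alg: "algebra (points P) (blocks P)"
  then have "pervin_space P"
    unfolding pervin_space_def by (metis algebra.top algebra_iff_Int algebra_iff_Un)
  then show "pervin_symmetric P" using alg by (simp add: pervin_symmetric_def)
qed (simp add: pervin_symmetric_def)

lemma pervin_symmetric_symmetrization:
  assumes "pervin_space P"
  shows "pervin_symmetric (symmetrization P)"
proof -
  have "algebra (points P) (algebra (points P) hull blocks P)"
    using assms by (intro algebra_hull) (simp add: pervin_space_def)
  then show ?thesis
    by (simp add: pervin_symmetric_iff_algebra symmetrization_def)
qed

text \<open>A compact space admits no proper dense extension: for a point \<open>y\<close> of the extension, density gives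
  the finite intersection property to the traces of the blocks around \<open>y\<close>, and any point common to
  all of these closed traces is mapped to \<open>y\<close>, because blocks separate points (\<open>T\<^sub>0\<close>) and come with
  their complements. A bijective extremal monomorphism is an isomorphism.\<close>

lemma symmetric_complete_if_compact:
  fixes P :: "'a pervin"
  assumes comp: "compact_space K" and top: "topspace K = points P"
    and clo: "\<And>S. S \<in> blocks P \<Longrightarrow> closedin K S"
  shows "symmetric_complete P"
  unfolding symmetric_complete_def
proof (intro allI impI, elim conjE)
  fix Q :: "'a set set pervin" and f
  assume "pervin_symmetric Q" and t0: "pervin_t0 Q"
    and dense: "pervin_dense P Q f" and extr: "pervin_extremal_mono P Q f"
  then have Q: "pervin_space Q" unfolding pervin_symmetric_def by auto
  have hom: "f \<in> points P \<rightarrow>\<^sub>E points Q" "\<And>T. T \<in> blocks Q \<Longrightarrow> f -` T \<inter> points P \<in> blocks P"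
    using extr unfolding pervin_extremal_mono_def pervin_hom_def by auto
  have surj: "\<exists>x \<in> points P. f x = y" if y: "y \<in> points Q" for y
  proof -
    define \<C> where "\<C> = {f -` T \<inter> points P |T. T \<in> blocks Q \<and> y \<in> T}"
    have top_in: "points Q \<in> blocks Q" using Q unfolding pervin_space_def by auto
    have fip: "\<Inter>\<F> \<noteq> {}" if \<F>: "finite \<F>" "\<F> \<subseteq> \<C>" for \<F>
    proof -
      \<comment> \<open>Density speaks of one block, so the finitely many traces are replaced by the trace of an
        intersection of blocks.\<close>
      have "\<exists>T \<in> blocks Q. y \<in> T \<and> f -` T \<inter> points P \<subseteq> \<Inter>\<F>"
        using \<F>
      proof (induction \<F> rule: finite_induct)
        case empty
        then show ?case using top_in y by auto
      next
        case (insert C \<F>)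
        then obtain S T where "S \<in> blocks Q" "y \<in> S" "f -` S \<inter> points P \<subseteq> \<Inter>\<F>"
          "T \<in> blocks Q" "y \<in> T" "C = f -` T \<inter> points P"
          unfolding \<C>_def by auto
        then show ?case
          using Q unfolding pervin_space_def by (intro bexI[of _ "S \<inter> T"]) auto
      qed
      then obtain T where T: "T \<in> blocks Q" "y \<in> T" "f -` T \<inter> points P \<subseteq> \<Inter>\<F>" by blast
      then obtain x where "x \<in> points P" "f x \<in> T" using pervin_dense_meets[OF Q dense T(1)] by blast
      then have "x \<in> \<Inter>\<F>" using T(3) by blast
      then show ?thesis by blast
    qed
    have "closedin K C" if "C \<in> \<C>" for C
      using that clo hom(2) unfolding \<C>_def by auto
    then have "\<Inter>\<C> \<noteq> {}"
      using comp[unfolded compact_space_fip, rule_format, of \<C>] fip by simp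
    then obtain x where x: "x \<in> \<Inter>\<C>" by blast
    then have "x \<in> points P" using top_in y unfolding \<C>_def by blast
    moreover have "f x \<in> T" if "T \<in> blocks Q" "y \<in> T" for T
      using x that unfolding \<C>_def by blast
    moreover have "f x \<notin> T" if "T \<in> blocks Q" "y \<notin> T" for T
    proof -
      have "points Q - T \<in> blocks Q"
        using \<open>pervin_symmetric Q\<close> that(1) unfolding pervin_symmetric_def algebra_iff_Un by blast
      then show ?thesis using calculation(2) that y by blast
    qed
    ultimately show ?thesis
      using t0 hom(1) y unfolding pervin_t0_iff[OF Q] by (metis PiE_mem)
  qed
  define g where "g = (\<lambda>y\<in>points Q. inv_into (points P) f y)"
  have inj: "inj_on f (points P)" using extr unfolding pervin_extremal_mono_def by auto
  have fg: "g y \<in> points P" "f (g y) = y" if "y \<in> points Q" for y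
  proof -
    have "y \<in> f ` points P" using surj[OF that] by blast
    then show "g y \<in> points P" "f (g y) = y"
      using that unfolding g_def by (simp_all only: inv_into_into f_inv_into_f restrict_apply if_True)
  qed
  have gf: "g (f x) = x" if "x \<in> points P" for x
    using inj hom(1) that unfolding g_def by auto
  have "g \<in> pervin_hom Q P"
    unfolding pervin_hom_def
  proof (intro CollectI conjI ballI)
    show "g \<in> points Q \<rightarrow>\<^sub>E points P" using fg(1) unfolding g_def by auto
    fix S assume "S \<in> blocks P"
    then obtain T where T: "T \<in> blocks Q" "S = f -` T \<inter> points P"
      using extr unfolding pervin_extremal_mono_def by blast
    have "T \<subseteq> points Q" using Q T(1) unfolding pervin_space_def by blast
    then have "g -` S \<inter> points Q = T" using fg T(2) by auto
    then show "g -` S \<inter> points Q \<in> blocks Q" using T(1) by simp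
  qed
  moreover have "f \<in> pervin_hom P Q" using extr unfolding pervin_extremal_mono_def by blast
  ultimately show "pervin_iso P Q f"
    unfolding pervin_iso_def using fg(2) gf by (intro conjI bexI[of _ g]) simp_all
qed

text \<open>The patch-clopen sets form a Boolean algebra. It contains the positive clopens, hence also the
  Boolean algebra that these generate, whose members are thus closed in the compact patch topology.\<close>

lemma pervin_complete_Clop_Pos:
  assumes X: "bitopological_space X" and "compact_space (patch X)"
  shows "pervin_complete (on_obj Clop_Pos X)"
  unfolding pervin_complete_def
proof (rule symmetric_complete_if_compact[OF assms(2)])
  have [simp]: "points (on_obj Clop_Pos X) = bpoints X" "blocks (on_obj Clop_Pos X) = clop_pos X"
    by (simp_all add: Clop_Pos_def)
  show "topspace (patch X) = points (symmetrization (on_obj Clop_Pos X))"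
    by (simp add: symmetrization_def topspace_patch[OF X])
  let ?\<C> = "{S. openin (patch X) S \<and> closedin (patch X) S}"
  have "algebra (bpoints X) ?\<C>"
    unfolding algebra_iff_Un topspace_patch[OF X, symmetric]
    by (auto dest: openin_subset closedin_subset)
  moreover have "clop_pos X \<subseteq> ?\<C>"
    using X openin_subset unfolding clop_pos_def bitopological_space_def
    by (auto simp: closedin_def topspace_patch[OF X] openin_patch)
  ultimately have "algebra (bpoints X) hull clop_pos X \<subseteq> ?\<C>"
    by (simp add: hull_minimal)
  then show "closedin (patch X) S" if "S \<in> blocks (symmetrization (on_obj Clop_Pos X))" for S
    using that by (auto simp: symmetrization_def)
qed

section \<open>Complete Pervin spaces yield compact zero-dimensional bispaces\<close>

text \<open>The Prime Ideal Theorem speaks of abstract lattices, where joins and meets are defined by their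
  universal property. In a lattice of sets these are union and intersection.\<close>

lemma lattice_of_sets:
  fixes \<B> :: "'a set set"
  defines "L \<equiv> \<lparr>carrier = \<B>, eq = (=), le = (\<subseteq>)\<rparr>"
  assumes "{} \<in> \<B>" "X \<in> \<B>" "\<B> \<subseteq> Pow X"
    and Un: "\<And>S T. \<lbrakk>S \<in> \<B>; T \<in> \<B>\<rbrakk> \<Longrightarrow> S \<union> T \<in> \<B>"
    and Int: "\<And>S T. \<lbrakk>S \<in> \<B>; T \<in> \<B>\<rbrakk> \<Longrightarrow> S \<inter> T \<in> \<B>"
  shows "bounded_lattice L" "distributive_lattice L"
    and "\<And>S T. \<lbrakk>S \<in> \<B>; T \<in> \<B>\<rbrakk> \<Longrightarrow> S \<squnion>\<^bsub>L\<^esub> T = S \<union> T"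
    and "\<And>S T. \<lbrakk>S \<in> \<B>; T \<in> \<B>\<rbrakk> \<Longrightarrow> S \<sqinter>\<^bsub>L\<^esub> T = S \<inter> T"
proof -
  have lub: "least L R (Upper L {S, T}) \<longleftrightarrow> R = S \<union> T" if ST: "S \<in> \<B>" "T \<in> \<B>" for R S T
  proof -
    have "Upper L {S, T} = {V \<in> \<B>. S \<union> T \<subseteq> V}" using ST unfolding Upper_def L_def by auto
    then have "least L R (Upper L {S, T}) \<longleftrightarrow>
        R \<in> {V \<in> \<B>. S \<union> T \<subseteq> V} \<and> (\<forall>U \<in> {V \<in> \<B>. S \<union> T \<subseteq> V}. R \<subseteq> U)"
      by (simp add: least_def L_def)
    moreover have "S \<union> T \<in> {V \<in> \<B>. S \<union> T \<subseteq> V}" using Un[OF ST] by simp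
    ultimately show ?thesis by (metis (lifting) mem_Collect_eq subset_antisym)
  qed
  have glb: "greatest L R (Lower L {S, T}) \<longleftrightarrow> R = S \<inter> T" if ST: "S \<in> \<B>" "T \<in> \<B>" for R S T
  proof -
    have "Lower L {S, T} = {V \<in> \<B>. V \<subseteq> S \<inter> T}" using ST unfolding Lower_def L_def by auto
    then have "greatest L R (Lower L {S, T}) \<longleftrightarrow>
        R \<in> {V \<in> \<B>. V \<subseteq> S \<inter> T} \<and> (\<forall>U \<in> {V \<in> \<B>. V \<subseteq> S \<inter> T}. U \<subseteq> R)"
      by (simp add: greatest_def L_def)
    moreover have "S \<inter> T \<in> {V \<in> \<B>. V \<subseteq> S \<inter> T}" using Int[OF ST] by simp
    ultimately show ?thesis by (metis (lifting) mem_Collect_eq subset_antisym)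
  qed
  have order: "partial_order L" unfolding L_def by standard auto
  interpret partial_order L by (rule order)
  have "upper_semilattice L" "lower_semilattice L"
    using lub glb by (unfold_locales, simp add: L_def)+
  then have lattice: "lattice L" by (simp add: lattice_def)
  moreover have "least L {} (carrier L)" "greatest L X (carrier L)"
    using assms(2-4) unfolding least_def greatest_def L_def by auto
  then have "weak_partial_order_bottom L" "weak_partial_order_top L"
    by (unfold_locales, blast)+
  ultimately show "bounded_lattice L" by (simp add: bounded_lattice_def)
  show join: "S \<squnion>\<^bsub>L\<^esub> T = S \<union> T" if "S \<in> \<B>" "T \<in> \<B>" for S T
    unfolding join_def sup_def using lub[OF that] by simp
  show meet: "S \<sqinter>\<^bsub>L\<^esub> T = S \<inter> T" if "S \<in> \<B>" "T \<in> \<B>" for S T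
    unfolding meet_def inf_def using glb[OF that] by simp
  have "carrier L = \<B>" by (simp add: L_def)
  then show "distributive_lattice L"
    unfolding distributive_lattice_def using lattice
    by (simp add: join meet Un Int Int_Un_distrib)
qed

text \<open>An ultrafilter of a Boolean algebra of sets is described by the homomorphism to the two-element
  Boolean algebra whose kernel is its complement: membership commutes with complements and
  intersections. Properness follows, since \<open>{}\<close> is the intersection of \<open>X\<close> with its complement.\<close>

definition ultrafilters :: "'a set \<Rightarrow> 'a set set \<Rightarrow> 'a set set set" where
  "ultrafilters X \<B> = {\<U>. \<U> \<subseteq> \<B> \<and> (\<forall>S \<in> \<B>. X - S \<in> \<U> \<longleftrightarrow> S \<notin> \<U>) \<and>
     (\<forall>S \<in> \<B>. \<forall>T \<in> \<B>. S \<inter> T \<in> \<U> \<longleftrightarrow> S \<in> \<U> \<and> T \<in> \<U>)}"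

text \<open>The Prime Ideal Theorem in the form used for Boolean algebras of sets: in a Boolean algebra the
  complement of a prime ideal is an ultrafilter.\<close>

lemma ultrafilter_avoiding_ideal:
  fixes \<B> \<I> :: "'a set set"
  assumes PIT: "prime_ideal_theorem TYPE('a set)" and alg: "algebra X \<B>"
    and \<I>: "\<I> \<subseteq> \<B>" "{} \<in> \<I>" "X \<notin> \<I>"
    and down: "\<And>S T. \<lbrakk>S \<in> \<B>; T \<in> \<I>; S \<subseteq> T\<rbrakk> \<Longrightarrow> S \<in> \<I>"
    and un: "\<And>S T. \<lbrakk>S \<in> \<I>; T \<in> \<I>\<rbrakk> \<Longrightarrow> S \<union> T \<in> \<I>"
  shows "\<exists>\<U> \<in> ultrafilters X \<B>. \<U> \<inter> \<I> = {}"
proof -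
  interpret algebra X \<B> by fact
  define L :: "'a set gorder" where "L = \<lparr>carrier = \<B>, eq = (=), le = (\<subseteq>)\<rparr>"
  have L: "carrier L = \<B>" "\<And>S T. S \<sqsubseteq>\<^bsub>L\<^esub> T \<longleftrightarrow> S \<subseteq> T" by (simp_all add: L_def)
  have lat: "bounded_lattice L" "distributive_lattice L"
    and join: "\<And>S T. \<lbrakk>S \<in> \<B>; T \<in> \<B>\<rbrakk> \<Longrightarrow> S \<squnion>\<^bsub>L\<^esub> T = S \<union> T"
    and meet: "\<And>S T. \<lbrakk>S \<in> \<B>; T \<in> \<B>\<rbrakk> \<Longrightarrow> S \<sqinter>\<^bsub>L\<^esub> T = S \<inter> T"
    using lattice_of_sets[OF empty_sets top space_closed Un Int] unfolding L_def by blast+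
  have "S \<squnion>\<^bsub>L\<^esub> T \<in> \<I>" if "S \<in> \<I>" "T \<in> \<I>" for S T
    using that un[OF that] \<I>(1) join[of S T] by (simp add: subset_iff)
  then have "proper_lattice_ideal L \<I>"
    unfolding proper_lattice_ideal_def lattice_ideal_def L using \<I> down top by blast
  then obtain \<P> where prime: "prime_lattice_ideal L \<P>" and sub: "\<I> \<subseteq> \<P>"
    using PIT lat unfolding prime_ideal_theorem_def by blast
  then have \<P>: "\<P> \<subseteq> \<B>" "\<P> \<noteq> \<B>"
    and Pdown: "\<And>S T. \<lbrakk>S \<in> \<B>; T \<in> \<P>; S \<subseteq> T\<rbrakk> \<Longrightarrow> S \<in> \<P>"
    and Pjoin: "\<And>S T. \<lbrakk>S \<in> \<P>; T \<in> \<P>\<rbrakk> \<Longrightarrow> S \<squnion>\<^bsub>L\<^esub> T \<in> \<P>"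
    and Pmeet: "\<And>S T. \<lbrakk>S \<in> \<B>; T \<in> \<B>; S \<sqinter>\<^bsub>L\<^esub> T \<in> \<P>\<rbrakk> \<Longrightarrow> S \<in> \<P> \<or> T \<in> \<P>"
    unfolding prime_lattice_ideal_def proper_lattice_ideal_def lattice_ideal_def L by blast+
  have Pun: "S \<union> T \<in> \<P>" if "S \<in> \<P>" "T \<in> \<P>" for S T
    using Pjoin[OF that] join[of S T] that \<P>(1) by (simp add: subset_iff)
  have Pint: "S \<in> \<P> \<or> T \<in> \<P>" if "S \<in> \<B>" "T \<in> \<B>" "S \<inter> T \<in> \<P>" for S T
    using Pmeet[of S T] meet[of S T] that by simp
  have "X \<notin> \<P>"
    using \<P> Pdown[of _ X] sets_into_space by blast
  have compl: "X - S \<in> \<P> \<longleftrightarrow> S \<notin> \<P>" if S: "S \<in> \<B>" for S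
  proof
    assume "X - S \<in> \<P>"
    moreover have "S \<union> (X - S) = X" using sets_into_space[OF S] by blast
    ultimately show "S \<notin> \<P>" using Pun[of S "X - S"] \<open>X \<notin> \<P>\<close> by auto
  next
    assume "S \<notin> \<P>"
    moreover have "S \<inter> (X - S) \<in> \<P>" using \<I>(2) sub by (simp add: subset_iff)
    ultimately show "X - S \<in> \<P>" using Pint[of S "X - S"] S compl_sets[OF S] by blast
  qed
  have inter: "S \<inter> T \<in> \<P> \<longleftrightarrow> S \<in> \<P> \<or> T \<in> \<P>" if "S \<in> \<B>" "T \<in> \<B>" for S T
    using Pint[OF that] Pdown[of "S \<inter> T" S] Pdown[of "S \<inter> T" T] Int[OF that] by blast
  have "\<B> - \<P> \<in> ultrafilters X \<B>"
    unfolding ultrafilters_def using compl inter compl_sets Int by (simp add: Diff_subset)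
  then show ?thesis using sub by blast
qed

text \<open>The Stone space of the algebra of blocks is a \<open>T\<^sub>0\<close> symmetric Pervin space whose blocks are the sets
  \<open>hat S\<close> of ultrafilters containing \<open>S\<close>. Sending a point to the family of blocks around it is a dense
  extremal monomorphism, since \<open>S\<close> is the preimage of \<open>hat S\<close>. Completeness makes it surjective. The
  points of the Stone space are families of subsets of the original carrier, so it is among the test
  spaces in the definition of completeness.\<close>

lemma ultrafilter_principal:
  fixes P :: "'a pervin"
  assumes complete: "symmetric_complete P" and sym: "pervin_symmetric P" and t0: "pervin_t0 P"
    and U: "\<U> \<in> ultrafilters (points P) (blocks P)"
  shows "\<exists>x \<in> points P. \<forall>S \<in> blocks P. S \<in> \<U> \<longleftrightarrow> x \<in> S"
proof -
  define X \<B> where "X = points P" and "\<B> = blocks P"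
  have P: "pervin_space P" and alg: "algebra X \<B>"
    using sym unfolding pervin_symmetric_def X_def \<B>_def by auto
  interpret algebra X \<B> by (rule alg)
  define hat where "hat S = {\<V> \<in> ultrafilters X \<B>. S \<in> \<V>}" for S
  define Q where "Q = \<lparr>points = ultrafilters X \<B>, blocks = hat ` \<B>\<rparr>"
  have Q_simps: "points Q = ultrafilters X \<B>" "blocks Q = hat ` \<B>" by (simp_all add: Q_def)
  have hat_compl: "ultrafilters X \<B> - hat S = hat (X - S)" if "S \<in> \<B>" for S
    using that unfolding hat_def ultrafilters_def by blast
  have hat_Int: "hat S \<inter> hat T = hat (S \<inter> T)" if "S \<in> \<B>" "T \<in> \<B>" for S T
    using that unfolding hat_def ultrafilters_def by blast
  \<comment> \<open>Properness makes \<open>hat {}\<close> empty, so that a nonempty block \<open>hat S\<close> has a point of \<open>S\<close>, as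
    density requires.\<close>
  have no_empty: "{} \<notin> \<V>" if "\<V> \<in> ultrafilters X \<B>" for \<V>
  proof -
    have "X \<in> \<V> \<longleftrightarrow> {} \<notin> \<V>" "{} \<inter> X \<in> \<V> \<longleftrightarrow> {} \<in> \<V> \<and> X \<in> \<V>"
      using that top empty_sets unfolding ultrafilters_def by (force, blast)
    then show ?thesis by simp
  qed
  have hat_empty: "hat {} = {}" using no_empty unfolding hat_def by blast
  have algQ: "algebra (points Q) (blocks Q)"
    unfolding algebra_iff_Int Q_simps
  proof (intro conjI ballI)
    show "hat ` \<B> \<subseteq> Pow (ultrafilters X \<B>)" unfolding hat_def by blast
    show "{} \<in> hat ` \<B>" using hat_empty empty_sets by (metis imageI)
    show "ultrafilters X \<B> - A \<in> hat ` \<B>" if "A \<in> hat ` \<B>" for A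
      using that by (auto simp: hat_compl intro!: imageI)
    show "A \<inter> B \<in> hat ` \<B>" if "A \<in> hat ` \<B>" "B \<in> hat ` \<B>" for A B
      using that by (auto simp: hat_Int intro!: imageI)
  qed
  then have symQ: "pervin_symmetric Q" by (simp add: pervin_symmetric_iff_algebra)
  then have Q: "pervin_space Q" by (simp add: pervin_symmetric_def)
  have t0Q: "pervin_t0 Q"
    unfolding pervin_t0_iff[OF Q] Q_simps
  proof (intro ballI impI)
    fix \<V> \<W> assume VW: "\<V> \<in> ultrafilters X \<B>" "\<W> \<in> ultrafilters X \<B>" "\<V> \<noteq> \<W>"
    then obtain S where S: "S \<in> \<B>" "\<not> (S \<in> \<V> \<longleftrightarrow> S \<in> \<W>)" unfolding ultrafilters_def by blast
    then show "\<exists>T \<in> hat ` \<B>. \<not> (\<V> \<in> T \<longleftrightarrow> \<W> \<in> T)"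
      using VW unfolding hat_def by (intro bexI[of _ "hat S"]) (auto simp: hat_def)
  qed
  define f where "f = (\<lambda>x\<in>X. {S \<in> \<B>. x \<in> S})"
  have f: "f x = {S \<in> \<B>. x \<in> S}" "f x \<in> ultrafilters X \<B>" if "x \<in> X" for x
    using that compl_sets Int unfolding f_def ultrafilters_def by auto
  have pre: "f -` hat S \<inter> X = S" if "S \<in> \<B>" for S
    using that f sets_into_space[OF that] unfolding hat_def by auto
  have "pervin_dense P Q f"
  proof (rule pervin_dense_if_meets[OF Q])
    fix A assume "A \<in> blocks Q" "A \<noteq> {}"
    then obtain S where S: "S \<in> \<B>" "A = hat S" "S \<noteq> {}" using hat_empty unfolding Q_simps by blast
    then obtain x where "x \<in> S" by blast
    then have "x \<in> X" "f x \<in> A" using pre[OF S(1)] S(2) by auto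
    then show "\<exists>x \<in> points P. f x \<in> A" unfolding X_def by blast
  qed
  moreover have "pervin_extremal_mono P Q f"
    unfolding pervin_extremal_mono_def
  proof (intro conjI ballI)
    have "f \<in> X \<rightarrow>\<^sub>E ultrafilters X \<B>" using f(2) unfolding f_def by auto
    moreover have "f -` A \<inter> X \<in> \<B>" if "A \<in> hat ` \<B>" for A
      using that by (auto simp: pre)
    ultimately show "f \<in> pervin_hom P Q"
      unfolding pervin_hom_def Q_simps X_def \<B>_def by blast
    show "inj_on f (points P)"
    proof (rule inj_onI)
      fix x y assume xy: "x \<in> points P" "y \<in> points P" and "f x = f y"
      then have "x \<in> S \<longleftrightarrow> y \<in> S" if "S \<in> \<B>" for S
        using f(1)[of x] f(1)[of y] that unfolding X_def by blast
      then show "x = y" using t0 xy unfolding pervin_t0_iff[OF P] \<B>_def by blast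
    qed
    fix S assume "S \<in> blocks P"
    then show "\<exists>T \<in> blocks Q. S = f -` T \<inter> points P"
      using pre unfolding Q_simps X_def \<B>_def by (intro bexI[of _ "hat S"]) auto
  qed
  ultimately have "pervin_iso P Q f"
    using complete symQ t0Q unfolding symmetric_complete_def by blast
  then obtain g where g: "g \<in> pervin_hom Q P" "\<forall>\<V> \<in> points Q. f (g \<V>) = \<V>"
    unfolding pervin_iso_def by blast
  have "\<U> \<in> points Q" using U by (simp add: Q_simps X_def \<B>_def)
  then have x: "g \<U> \<in> X" "f (g \<U>) = \<U>"
    using g unfolding pervin_hom_def X_def by auto
  then have "\<U> = {S \<in> \<B>. g \<U> \<in> S}" using f(1) by simp
  then have "\<forall>S \<in> blocks P. S \<in> \<U> \<longleftrightarrow> g \<U> \<in> S" unfolding \<B>_def by blast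
  then show ?thesis using x(1) unfolding X_def by blast
qed

lemma Sk_Pervin_simps:
  "bpoints (on_obj Sk_Pervin P) = points P"
  "pos (on_obj Sk_Pervin P) = topology_generated_by (blocks P)"
  "neg (on_obj Sk_Pervin P) = topology_generated_by ((\<lambda>S. points P - S) ` blocks P)"
  by (simp_all add: Sk_Pervin_def)

lemma openin_pos_Sk_Pervin_base:
  assumes "pervin_space P" "openin (pos (on_obj Sk_Pervin P)) U" "x \<in> U"
  shows "\<exists>S \<in> blocks P. x \<in> S \<and> S \<subseteq> U"
  using assms(2,3) unfolding Sk_Pervin_simps
  by (rule generated_topology_base) (use assms(1) in \<open>auto simp: pervin_space_def\<close>)

lemma openin_neg_Sk_Pervin_base:
  assumes "pervin_space P" "openin (neg (on_obj Sk_Pervin P)) U" "x \<in> U"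
  shows "\<exists>S \<in> (\<lambda>S. points P - S) ` blocks P. x \<in> S \<and> S \<subseteq> U"
  using assms(2,3) unfolding Sk_Pervin_simps
proof (rule generated_topology_base)
  fix S T assume "S \<in> (\<lambda>S. points P - S) ` blocks P" "T \<in> (\<lambda>S. points P - S) ` blocks P"
  then obtain S' T' where "S' \<in> blocks P" "T' \<in> blocks P" "S = points P - S'" "T = points P - T'"
    by blast
  then show "S \<inter> T \<in> (\<lambda>S. points P - S) ` blocks P"
    using assms(1) unfolding pervin_space_def by (intro image_eqI[of _ _ "S' \<union> T'"]) auto
next
  fix G y assume "G \<in> (\<lambda>S. points P - S) ` blocks P" "y \<in> G"
  then show "\<exists>S \<in> (\<lambda>S. points P - S) ` blocks P. y \<in> S \<and> S \<subseteq> G"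
    by (intro bexI[of _ G]) auto
qed

text \<open>The blocks and their complements generate the patch topology, and the generated Boolean algebra
  contains both and is closed under intersection.\<close>

lemma openin_patch_Sk_Pervin_base:
  assumes P: "pervin_space P" and "openin (patch (on_obj Sk_Pervin P)) U" "x \<in> U"
  shows "\<exists>S \<in> blocks (symmetrization P). x \<in> S \<and> S \<subseteq> U"
proof -
  have alg: "algebra (points P) (blocks (symmetrization P))"
    using pervin_symmetric_symmetrization[OF P]
    unfolding pervin_symmetric_def by (simp add: symmetrization_def)
  have sub: "blocks P \<subseteq> blocks (symmetrization P)"
    by (simp add: symmetrization_def hull_subset)
  have compl: "points P - S \<in> blocks (symmetrization P)" if "S \<in> blocks P" for S
    using alg sub that unfolding algebra_iff_Un by blast
  show ?thesis
    using assms(2,3) unfolding patch_def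
  proof (rule generated_topology_base)
    show "S \<inter> T \<in> blocks (symmetrization P)"
      if "S \<in> blocks (symmetrization P)" "T \<in> blocks (symmetrization P)" for S T
      using alg that unfolding algebra_iff_Int by blast
    fix G y
    assume "G \<in> {U. openin (pos (on_obj Sk_Pervin P)) U} \<union> {U. openin (neg (on_obj Sk_Pervin P)) U}"
      and y: "y \<in> G"
    then show "\<exists>S \<in> blocks (symmetrization P). y \<in> S \<and> S \<subseteq> G"
      using openin_pos_Sk_Pervin_base[OF P _ y] openin_neg_Sk_Pervin_base[OF P _ y] sub compl
      by blast
  qed
qed

lemma zero_dimensional_Sk_Pervin:
  fixes P :: "'a pervin"
  assumes P: "pervin_space P"
  shows "bispace_zero_dimensional (on_obj Sk_Pervin P)"
proof -
  let ?X = "on_obj Sk_Pervin P"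
  have pos: "blocks P \<subseteq> clop_pos ?X" by (rule blocks_subset_clop_pos_Sk_Pervin)
  then have neg: "(\<lambda>S. points P - S) ` blocks P \<subseteq> clop_neg ?X"
    using clop_neg_eq[OF bitopological_space_Sk_Pervin[OF P]] by (auto simp: Sk_Pervin_simps)
  have union: "\<exists>\<U> \<subseteq> \<C>. U = \<Union>\<U>"
    if "\<B> \<subseteq> \<C>" "\<And>x. x \<in> U \<Longrightarrow> \<exists>S \<in> \<B>. x \<in> S \<and> S \<subseteq> U" for \<B> \<C> :: "'a set set" and U
    by (rule exI[of _ "{S \<in> \<B>. S \<subseteq> U}"]) (use that in blast)
  show ?thesis
    unfolding bispace_zero_dimensional_def
    using union[OF pos openin_pos_Sk_Pervin_base[OF P]] union[OF neg openin_neg_Sk_Pervin_base[OF P]]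
    by simp
qed

lemma t0_patch_Sk_Pervin:
  assumes P: "pervin_space P" and "pervin_t0 P"
  shows "t0_space (patch (on_obj Sk_Pervin P))"
proof (rule t0_space_expansive)
  show "t0_space (pervin_topology P)" using assms(2) by (simp add: pervin_t0_def)
  show "topspace (patch (on_obj Sk_Pervin P)) = topspace (pervin_topology P)"
    using P by (simp add: topspace_patch bitopological_space_Sk_Pervin topspace_pervin Sk_Pervin_simps)
  show "openin (patch (on_obj Sk_Pervin P)) U" if "openin (pervin_topology P) U" for U
    using that by (intro openin_patch) (simp add: pervin_topology_def Sk_Pervin_simps)
qed

text \<open>The members of the generated Boolean algebra covered by finitely many sets of a given open cover form
  an ideal. If it were proper, some ultrafilter would avoid it; but the ultrafilter is fixed at a point
  \<open>x\<close>, and a basic neighbourhood of \<open>x\<close> inside a single set of the cover is in the ideal.\<close>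

lemma compact_patch_Sk_Pervin:
  fixes P :: "'a pervin"
  assumes PIT: "prime_ideal_theorem TYPE('a set)"
    and P: "pervin_space P" and t0: "pervin_t0 P" and complete: "pervin_complete P"
  shows "compact_space (patch (on_obj Sk_Pervin P))"
proof -
  define R where "R = symmetrization P"
  have symR: "pervin_symmetric R" unfolding R_def by (rule pervin_symmetric_symmetrization[OF P])
  then have R: "pervin_space R" and alg: "algebra (points R) (blocks R)"
    unfolding pervin_symmetric_def by auto
  have pts: "points R = points P" by (simp add: R_def symmetrization_def)
  have sub: "blocks P \<subseteq> blocks R" by (simp add: R_def symmetrization_def hull_subset)
  have t0R: "pervin_t0 R"
    unfolding pervin_t0_iff[OF R] pts
  proof (intro ballI impI)
    fix x y assume "x \<in> points P" "y \<in> points P" "x \<noteq> y"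
    then obtain S where "S \<in> blocks P" "\<not> (x \<in> S \<longleftrightarrow> y \<in> S)"
      using t0[unfolded pervin_t0_iff[OF P], rule_format, of x y] by auto
    then show "\<exists>S \<in> blocks R. \<not> (x \<in> S \<longleftrightarrow> y \<in> S)" using sub by (intro bexI[of _ S]) auto
  qed
  interpret algebra "points R" "blocks R" by (rule alg)
  have top_patch: "topspace (patch (on_obj Sk_Pervin P)) = points R"
    using P by (simp add: topspace_patch bitopological_space_Sk_Pervin Sk_Pervin_simps pts)
  show ?thesis
    unfolding compact_space top_patch
  proof (intro allI impI, elim conjE)
    fix \<V> assume op: "\<forall>V \<in> \<V>. openin (patch (on_obj Sk_Pervin P)) V" and cover: "\<Union>\<V> = points R"
    define \<I> where "\<I> = {S \<in> blocks R. \<exists>\<F>. finite \<F> \<and> \<F> \<subseteq> \<V> \<and> S \<subseteq> \<Union>\<F>}"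
    have "points R \<in> \<I>"
    proof (rule ccontr)
      assume "points R \<notin> \<I>"
      moreover have "{} \<in> \<I>" unfolding \<I>_def using empty_sets by blast
      moreover have "S \<union> T \<in> \<I>" if "S \<in> \<I>" "T \<in> \<I>" for S T
      proof -
        obtain \<F> where "S \<in> blocks R" "finite \<F>" "\<F> \<subseteq> \<V>" "S \<subseteq> \<Union>\<F>"
          using \<open>S \<in> \<I>\<close> unfolding \<I>_def by blast
        moreover obtain \<G> where "T \<in> blocks R" "finite \<G>" "\<G> \<subseteq> \<V>" "T \<subseteq> \<Union>\<G>"
          using \<open>T \<in> \<I>\<close> unfolding \<I>_def by blast
        ultimately show ?thesis
          unfolding \<I>_def by (intro CollectI conjI exI[of _ "\<F> \<union> \<G>"]) auto
      qed
      moreover have "S \<in> \<I>" if "S \<in> blocks R" "T \<in> \<I>" "S \<subseteq> T" for S T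
        using that unfolding \<I>_def by blast
      moreover have "\<I> \<subseteq> blocks R" unfolding \<I>_def by blast
      ultimately obtain \<U> where U: "\<U> \<in> ultrafilters (points R) (blocks R)" "\<U> \<inter> \<I> = {}"
        using ultrafilter_avoiding_ideal[OF PIT alg, of \<I>] by blast
      then obtain x where x: "x \<in> points R" "\<And>S. S \<in> blocks R \<Longrightarrow> S \<in> \<U> \<longleftrightarrow> x \<in> S"
        using ultrafilter_principal[OF _ symR t0R U(1)] complete
        unfolding pervin_complete_def R_def by blast
      obtain V where V: "V \<in> \<V>" "x \<in> V" using x(1) cover by blast
      then obtain S where S: "S \<in> blocks R" "x \<in> S" "S \<subseteq> V"
        using openin_patch_Sk_Pervin_base[OF P] op unfolding R_def by blast
      then have "S \<in> \<I>" unfolding \<I>_def using V(1) by (auto intro!: exI[of _ "{V}"])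
      then show False using U(2) x(2)[OF S(1)] S(2) by blast
    qed
    then obtain \<F> where "finite \<F>" "\<F> \<subseteq> \<V>" "points R \<subseteq> \<Union>\<F>" unfolding \<I>_def by blast
    then show "\<exists>\<F>. finite \<F> \<and> \<F> \<subseteq> \<V> \<and> \<Union>\<F> = points R"
      using cover by (intro exI[of _ \<F>]) auto
  qed
qed

text \<open>A positive clopen is patch-closed, hence compact, and is the union of the blocks inside it; finitely
  many of them suffice, and blocks are closed under finite unions.\<close>

lemma Clop_Pos_Sk_Pervin:
  assumes P: "pervin_space P" and comp: "compact_space (patch (on_obj Sk_Pervin P))"
  shows "on_obj Clop_Pos (on_obj Sk_Pervin P) = P"
proof -
  let ?X = "on_obj Sk_Pervin P"
  have X: "bitopological_space ?X" by (rule bitopological_space_Sk_Pervin[OF P])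
  have "U \<in> blocks P" if U: "U \<in> clop_pos ?X" for U
  proof -
    have pos: "openin (pos ?X) U" and neg: "openin (neg ?X) (points P - U)"
      using U unfolding clop_pos_def by (simp_all add: Sk_Pervin_simps(1))
    have "U \<subseteq> points P"
      using openin_subset[OF pos] X unfolding bitopological_space_def by (simp add: Sk_Pervin_simps(1))
    then have "closedin (patch ?X) U"
      using neg unfolding closedin_def topspace_patch[OF X] by (simp add: Sk_Pervin_simps(1) openin_patch)
    then have "compactin (patch ?X) U" using comp by (rule closedin_compact_space[rotated])
    moreover have "openin (patch ?X) S" if "S \<in> {S \<in> blocks P. S \<subseteq> U}" for S
      using that by (intro openin_patch) (simp add: Sk_Pervin_simps topology_generated_by_Basis)
    moreover have "U \<subseteq> \<Union>{S \<in> blocks P. S \<subseteq> U}"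
      using openin_pos_Sk_Pervin_base[OF P pos] by blast
    ultimately obtain \<F> where \<F>: "finite \<F>" "\<F> \<subseteq> {S \<in> blocks P. S \<subseteq> U}" "U \<subseteq> \<Union>\<F>"
      using compactinD by meson
    have "\<Union>\<F> \<in> blocks P" if "finite \<F>" "\<F> \<subseteq> blocks P" for \<F>
      using that P by (induction rule: finite_induct) (auto simp: pervin_space_def)
    then have "\<Union>\<F> \<in> blocks P" using \<F>(1,2) by blast
    moreover have "\<Union>\<F> = U" using \<F>(2,3) by blast
    ultimately show ?thesis by simp
  qed
  then have "clop_pos ?X = blocks P"
    using blocks_subset_clop_pos_Sk_Pervin by blast
  then show ?thesis by (simp add: Clop_Pos_def Sk_Pervin_simps(1))
qed

section \<open>The equivalence\<close>

theorem corollary5p11: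
  assumes "prime_ideal_theorem TYPE('a set)"
  shows "adjunction (BiTop :: ('a bispace, 'a \<Rightarrow> 'a) cat) Pervin
           Clop_Pos Sk_Pervin Clop_Sk_unit Clop_Sk_counit
       \<and> adjoint_equivalence (BiTop_KZ :: ('a bispace, 'a \<Rightarrow> 'a) cat) CPervin
           Clop_Pos Sk_Pervin Clop_Sk_unit Clop_Sk_counit"
proof
  show adj: "adjunction (BiTop :: ('a bispace, 'a \<Rightarrow> 'a) cat) Pervin
      Clop_Pos Sk_Pervin Clop_Sk_unit Clop_Sk_counit"
    by (rule adjunction_Clop_Sk)
  have KZ: "pervin_t0 (on_obj Clop_Pos X) \<and> pervin_complete (on_obj Clop_Pos X)"
    if "X \<in> Obj BiTop" "t0_space (patch X) \<and> compact_space (patch X) \<and> bispace_zero_dimensional X"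
    for X :: "'a bispace"
    using that pervin_t0_Clop_Pos[of X] pervin_complete_Clop_Pos[of X] by (simp add: BiTop_def)
  have C: "t0_space (patch (on_obj Sk_Pervin P)) \<and> compact_space (patch (on_obj Sk_Pervin P)) \<and>
      bispace_zero_dimensional (on_obj Sk_Pervin P)"
    if "P \<in> Obj Pervin" "pervin_t0 P \<and> pervin_complete P" for P :: "'a pervin"
    using that compact_patch_Sk_Pervin[OF assms, of P] t0_patch_Sk_Pervin[of P]
      zero_dimensional_Sk_Pervin[of P] by (simp add: Pervin_def)
  interpret adjunction "BiTop_KZ :: ('a bispace, 'a \<Rightarrow> 'a) cat" CPervin
      Clop_Pos Sk_Pervin Clop_Sk_unit Clop_Sk_counit
    unfolding BiTop_KZ_def CPervin_def 
    by (rule adjunction_full_subcategory[OF adj], erule (1) KZ, erule (1) C)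
  show "adjoint_equivalence (BiTop_KZ :: ('a bispace, 'a \<Rightarrow> 'a) cat) CPervin
      Clop_Pos Sk_Pervin Clop_Sk_unit Clop_Sk_counit"
  proof
    fix X :: "'a bispace" assume X: "X \<in> Obj BiTop_KZ"
    then have "on_obj Sk_Pervin (on_obj Clop_Pos X) = X"
      by (intro Sk_Pervin_Clop_Pos) (simp_all add: BiTop_KZ_def BiTop_def full_subcategory_simps)
    moreover have "Clop_Sk_unit X = Idt BiTop_KZ X"
      by (simp add: Clop_Sk_unit_def BiTop_KZ_def BiTop_def full_subcategory_simps)
    ultimately show "iso_arrow BiTop_KZ X (on_obj Sk_Pervin (on_obj Clop_Pos X)) (Clop_Sk_unit X)"
      using left.dom.iso_arrow_idt[OF X] by simp
  next
    fix P :: "'a pervin" assume P: "P \<in> Obj CPervin"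
    then have "on_obj Clop_Pos (on_obj Sk_Pervin P) = P"
      using C[of P] by (intro Clop_Pos_Sk_Pervin)
        (simp_all add: CPervin_def Pervin_def full_subcategory_simps)
    moreover have "Clop_Sk_counit P = Idt CPervin P"
      by (simp add: Clop_Sk_counit_def CPervin_def Pervin_def full_subcategory_simps)
    ultimately show "iso_arrow CPervin (on_obj Clop_Pos (on_obj Sk_Pervin P)) P (Clop_Sk_counit P)"
      using left.cod.iso_arrow_idt[OF P] by simp
  qed
qed

end
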